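(* Let $G$ be a minimally $3$-connected graph. For every subgraph $G'=(V',E')$ of $G$ with $|V'|\ge 8$ we have \[|E'|\le r_2(G')+|V'|-6\le 3(|V'|-3).\]
   Context: All graphs are finite and simple. A graph is minimally $3$-connected if it is $3$-connected but $G-e$ is not $3$-connected for every edge $e$. $\mathcal{R}_2(G)$ is the row matroid of the rigidity matrix $R(G,p)$ of a generic framework $p:V\to\mathbb{R}^2$ (coordinates algebraically independent over $\mathbb{Q}$; the row of edge $xy$ has $p(x)-p(y)$ in the two columns of $x$, $p(y)-p(x)$ in those of $y$, zeros elsewhere), and $r_2(G)$ is its rank. *)

theory Defs
  imports "HOL-Analysis.Analysis" "HOL-Library.Poly_Mapping"
begin

definition simple_graph :: "'v set \<Rightarrow> 'v set set \<Rightarrow> bool" where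
  "simple_graph V E \<longleftrightarrow> finite V \<and> (\<forall>e\<in>E. e \<subseteq> V \<and> card e = 2)"

definition subgraph :: "'v set \<Rightarrow> 'v set set \<Rightarrow> 'v set \<Rightarrow> 'v set set \<Rightarrow> bool" where
  "subgraph V' E' V E \<longleftrightarrow> simple_graph V' E' \<and> V' \<subseteq> V \<and> E' \<subseteq> E"

definition graph_connected :: "'v set \<Rightarrow> 'v set set \<Rightarrow> bool" where
  "graph_connected V E \<longleftrightarrow> V \<noteq> {} \<and> (\<forall>u\<in>V. \<forall>v\<in>V. (u, v) \<in> {(x, y). {x, y} \<in> E}\<^sup>*)"

definition k_connected :: "nat \<Rightarrow> 'v set \<Rightarrow> 'v set set \<Rightarrow> bool" where
  "k_connected k V E \<longleftrightarrow> card V > k \<and>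
     (\<forall>X. X \<subseteq> V \<and> card X < k \<longrightarrow> graph_connected (V - X) {e \<in> E. e \<inter> X = {}})"

definition minimally_3_connected :: "'v set \<Rightarrow> 'v set set \<Rightarrow> bool" where
  "minimally_3_connected V E \<longleftrightarrow>
     k_connected 3 V E \<and> (\<forall>e\<in>E. \<not> k_connected 3 V (E - {e}))"

text \<open>Multivariate polynomials over the rationals with variables in \<open>'i\<close> are finitely supported
  maps from monomials (finitely supported exponent functions) to coefficients.\<close>

definition eval_mpoly :: "('i \<Rightarrow> real) \<Rightarrow> (('i \<Rightarrow>\<^sub>0 nat) \<Rightarrow>\<^sub>0 rat) \<Rightarrow> real" where
  "eval_mpoly x P =
     (\<Sum>m\<in>Poly_Mapping.keys P. of_rat (Poly_Mapping.lookup P m) *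
        (\<Prod>i\<in>Poly_Mapping.keys m. x i ^ Poly_Mapping.lookup m i))"

definition alg_independent_over_rat :: "('i \<Rightarrow> real) \<Rightarrow> 'i set \<Rightarrow> bool" where
  "alg_independent_over_rat x I \<longleftrightarrow>
     (\<forall>P. P \<noteq> 0 \<and> (\<forall>m\<in>Poly_Mapping.keys P. Poly_Mapping.keys m \<subseteq> I) \<longrightarrow> eval_mpoly x P \<noteq> 0)"

definition generic :: "'v set \<Rightarrow> ('v \<Rightarrow> real^2) \<Rightarrow> bool" where
  "generic V p \<longleftrightarrow> alg_independent_over_rat (\<lambda>(v, i). p v $ i) (V \<times> UNIV)"

text \<open>Rows of the rigidity matrix are vectors with a block of two real entries for each vertex.
  The row of the edge \<open>xy\<close> is symmetric in \<open>x\<close> and \<open>y\<close>. The blocks of elements of the vertex type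
  outside the vertex set of the graph are zero and do not affect the rank.\<close>

definition rigidity_row :: "('v::finite \<Rightarrow> real^2) \<Rightarrow> 'v \<Rightarrow> 'v \<Rightarrow> (real^2)^'v" where
  "rigidity_row p x y =
     (\<chi> v. if v = x then p x - p y else if v = y then p y - p x else 0)"

definition rigidity_rank :: "'v::finite set set \<Rightarrow> ('v \<Rightarrow> real^2) \<Rightarrow> nat" where
  "rigidity_rank E p = dim {rigidity_row p x y | x y. {x, y} \<in> E}"

text \<open>The rank is the same for all generic frameworks, so the choice of \<open>p\<close> is immaterial.\<close>

definition r2 :: "'v::finite set \<Rightarrow> 'v set set \<Rightarrow> nat" where
  "r2 V E = rigidity_rank E (SOME p. generic V p)"

end

(* The argument uses only one consequence of minimality, and it passes to subgraphs: the ends of an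
   edge uv can be separated in G - uv by at most two vertices.  Call |E| - r_2 the nullity.

   Deleting a vertex of degree at most 2 does not decrease the nullity, and deleting a vertex of
   degree 3 decreases it by at most 1.  A graph with at most 9 vertices and the separation property
   has a vertex of degree at most 3; hence small cases yield nullity at most 1 on 5 or 6 vertices and
   at most 2 on 7 or 8 vertices, the critical point being that a graph on 7 vertices with nullity 2
   is a union of two copies of K_4 (K_{3,4} has nullity 1 because six generic points lie on no
   conic).  On n >= 9 vertices either there is a vertex of degree at most 3, or every degree is at
   least 4; in the latter case a separation of an edge yields two sides with at least 6 vertices
   each, and gluing them along at most two vertices and adding the edge raises the total nullity by
   at most 2.  By induction the nullity is at most n - 6 for n >= 8. *)
theory Submission
  imports Defs
begin

section \<open>Polynomials and algebraic independence\<close>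

text \<open>The bound n - 6 breaks just below n = 8: two copies of K_4 sharing a vertex have 7
  vertices and nullity 2. A side of a separation may well have only 6 or 7 vertices, so the
  induction also carries the weaker bound n - 5, from n = 6 on. For gluing the weaker one is enough:
  the sizes n1 and n2 of the sides add up to at most n + 2, whence (n1 - 5) + (n2 - 5) + 2 <= n - 6.

  Counting edges cannot settle K_{3,4}: its subgraph K_{3,3} has exactly 2 * 6 - 3 = 9 edges, yet
  its rows are dependent when the six points lie on a conic. The position of the points therefore
  has to enter. Algebraic independence is turned into a few polynomial conditions (distinct points,
  no three on a line, no six on a conic), each witnessed by one explicit placement.

  The second inequality of the theorem amounts to r_2 <= 2n - 3. It comes from regarding rows as
  systems of forces in equilibrium, the same view that controls the gluing.\<close>

definition monom_eval :: "('i \<Rightarrow> real) \<Rightarrow> ('i \<Rightarrow>\<^sub>0 nat) \<Rightarrow> real" where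
  "monom_eval x m = (\<Prod>i\<in>Poly_Mapping.keys m. x i ^ Poly_Mapping.lookup m i)"

lemma monom_eval_UNIV:
  fixes x :: "'i::finite \<Rightarrow> real"
  shows "monom_eval x m = (\<Prod>i\<in>UNIV. x i ^ Poly_Mapping.lookup m i)"
  unfolding monom_eval_def
  by (rule prod.mono_neutral_left) (auto simp: in_keys_iff)

lemma monom_eval_add:
  fixes x :: "'i::finite \<Rightarrow> real"
  shows "monom_eval x (m + n) = monom_eval x m * monom_eval x n"
  by (simp add: monom_eval_UNIV lookup_add power_add prod.distrib)

lemma eval_mpoly_superset:
  assumes "finite A" "Poly_Mapping.keys P \<subseteq> A"
  shows "eval_mpoly x P = (\<Sum>m\<in>A. of_rat (Poly_Mapping.lookup P m) * monom_eval x m)"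
  unfolding eval_mpoly_def monom_eval_def
  by (rule sum.mono_neutral_left) (use assms in \<open>auto simp: in_keys_iff\<close>)

lemma eval_mpoly_add: "eval_mpoly x (P + Q) = eval_mpoly x P + eval_mpoly x Q"
proof -
  let ?A = "Poly_Mapping.keys P \<union> Poly_Mapping.keys Q"
  have "Poly_Mapping.keys (P + Q) \<subseteq> ?A" by (rule Poly_Mapping.keys_add)
  then show ?thesis
    by (simp add: eval_mpoly_superset[of ?A] lookup_add of_rat_add distrib_right sum.distrib)
qed

lemma eval_mpoly_zero [simp]: "eval_mpoly x 0 = 0"
  by (simp add: eval_mpoly_def)

lemma eval_mpoly_single [simp]:
  "eval_mpoly x (Poly_Mapping.single m c) = of_rat c * monom_eval x m"
  by (subst eval_mpoly_superset[of "{m}"]) auto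

lemma eval_mpoly_sum: "eval_mpoly x (\<Sum>a\<in>A. f a) = (\<Sum>a\<in>A. eval_mpoly x (f a))"
  by (induction A rule: infinite_finite_induct) (auto simp: eval_mpoly_add)

lemma sum_single_lookup:
  "(\<Sum>m\<in>Poly_Mapping.keys P. Poly_Mapping.single m (Poly_Mapping.lookup P m)) = P"
  by (rule poly_mapping_eqI) (simp add: lookup_sum lookup_single when_def in_keys_iff)

lemma eval_mpoly_mult:
  fixes x :: "'i::finite \<Rightarrow> real"
  shows "eval_mpoly x (P * Q) = eval_mpoly x P * eval_mpoly x Q"
proof -
  let ?s = "\<lambda>P. (\<Sum>m\<in>Poly_Mapping.keys P. Poly_Mapping.single m (Poly_Mapping.lookup P m))"
  have "eval_mpoly x (?s P * ?s Q) = eval_mpoly x (?s P) * eval_mpoly x (?s Q)"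
    by (simp add: sum_product mult_single eval_mpoly_sum monom_eval_add of_rat_mult mult_ac)
  then show ?thesis by (simp add: sum_single_lookup)
qed

text \<open>Polynomiality is a property of real functions here, so that geometric expressions are
  recognised by closure rules and no coefficient map has to be written down.\<close>

definition rat_polynomial :: "'i set \<Rightarrow> (('i \<Rightarrow> real) \<Rightarrow> real) \<Rightarrow> bool" where
  "rat_polynomial I f \<longleftrightarrow>
     (\<exists>P. (\<forall>m\<in>Poly_Mapping.keys P. Poly_Mapping.keys m \<subseteq> I) \<and> (\<forall>x. eval_mpoly x P = f x))"

lemma rat_polynomial_coord: "i \<in> I \<Longrightarrow> rat_polynomial I (\<lambda>x. x i)"
  unfolding rat_polynomial_def
  by (rule exI[of _ "Poly_Mapping.single (Poly_Mapping.single i 1) 1"])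
     (auto simp: monom_eval_def)

lemma rat_polynomial_add:
  "rat_polynomial I f \<Longrightarrow> rat_polynomial I g \<Longrightarrow> rat_polynomial I (\<lambda>x. f x + g x)"
  unfolding rat_polynomial_def
  by (metis (no_types, lifting) Poly_Mapping.keys_add UnE eval_mpoly_add subsetD)

lemma rat_polynomial_mult:
  fixes f :: "('i::finite \<Rightarrow> real) \<Rightarrow> real"
  assumes "rat_polynomial I f" "rat_polynomial I g"
  shows "rat_polynomial I (\<lambda>x. f x * g x)"
proof -
  from assms obtain P Q where
    P: "\<forall>m\<in>Poly_Mapping.keys P. Poly_Mapping.keys m \<subseteq> I" "\<forall>x. eval_mpoly x P = f x" and
    Q: "\<forall>m\<in>Poly_Mapping.keys Q. Poly_Mapping.keys m \<subseteq> I" "\<forall>x. eval_mpoly x Q = g x"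
    unfolding rat_polynomial_def by blast
  have "Poly_Mapping.keys m \<subseteq> I" if m: "m \<in> Poly_Mapping.keys (P * Q)" for m
  proof -
    obtain a b where "a \<in> Poly_Mapping.keys P" "b \<in> Poly_Mapping.keys Q" "m = a + b"
      using subsetD[OF Poly_Mapping.keys_mult m] by auto
    then show ?thesis using P(1) Q(1) Poly_Mapping.keys_add[of a b] by blast
  qed
  then show ?thesis unfolding rat_polynomial_def
    by (intro exI[of _ "P * Q"]) (simp add: eval_mpoly_mult P Q)
qed

lemma rat_polynomial_uminus:
  fixes f :: "('i::finite \<Rightarrow> real) \<Rightarrow> real"
  assumes "rat_polynomial I f"
  shows "rat_polynomial I (\<lambda>x. - f x)"
proof -
  have "rat_polynomial I (\<lambda>x::'i \<Rightarrow> real. -1)"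
    unfolding rat_polynomial_def
    by (rule exI[of _ "Poly_Mapping.single 0 (-1)"]) (auto simp: monom_eval_def)
  from rat_polynomial_mult[OF this assms] show ?thesis by simp
qed

lemma rat_polynomial_diff:
  fixes f :: "('i::finite \<Rightarrow> real) \<Rightarrow> real"
  assumes "rat_polynomial I f" "rat_polynomial I g"
  shows "rat_polynomial I (\<lambda>x. f x - g x)"
  using rat_polynomial_add[OF assms(1) rat_polynomial_uminus[OF assms(2)]] by simp

lemmas rat_polynomial_intros =
  rat_polynomial_coord rat_polynomial_add rat_polynomial_mult rat_polynomial_diff

text \<open>A polynomial representing \<open>f\<close> is not the zero polynomial, because
  \<open>f y\<close> is nonzero; independence then forbids a zero at \<open>x\<close>. One
  well-chosen \<open>y\<close> thus certifies a condition at every independent point.\<close>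

lemma alg_independent_nonzero:
  assumes "alg_independent_over_rat x I" "rat_polynomial I f" "f y \<noteq> 0"
  shows "f x \<noteq> 0"
  using assms unfolding alg_independent_over_rat_def rat_polynomial_def
  by (metis eval_mpoly_zero)

text \<open>A polynomial is determined by the finite set of its pairs of monomial and nonzero
  coefficient, and those pairs form a countable type.\<close>

lemma countable_mpoly: "countable (UNIV :: (('i::finite \<Rightarrow>\<^sub>0 nat) \<Rightarrow>\<^sub>0 rat) set)"
proof -
  have "countable (UNIV :: ('i \<Rightarrow>\<^sub>0 nat) set)"
    by (rule countable_image_inj_on[of Poly_Mapping.lookup])
       (auto intro: injI countable_subset[OF subset_UNIV] poly_mapping_eqI)
  then have "countable (UNIV :: (('i \<Rightarrow>\<^sub>0 nat) \<times> rat) set)"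
    by (simp flip: UNIV_Times_UNIV)
  then have fin: "countable {A :: (('i \<Rightarrow>\<^sub>0 nat) \<times> rat) set. finite A \<and> A \<subseteq> UNIV}"
    by (rule countable_Collect_finite_subset)
  let ?g = "\<lambda>P :: ('i \<Rightarrow>\<^sub>0 nat) \<Rightarrow>\<^sub>0 rat. (\<lambda>m. (m, Poly_Mapping.lookup P m)) ` Poly_Mapping.keys P"
  have "inj ?g"
  proof (rule injI, rule poly_mapping_eqI)
    fix P Q m assume eq: "?g P = ?g Q"
    have "m \<in> Poly_Mapping.keys P \<longleftrightarrow> m \<in> Poly_Mapping.keys Q"
      using eq by (metis (mono_tags, lifting) fst_conv image_iff)
    moreover have "Poly_Mapping.lookup P m = Poly_Mapping.lookup Q m" if "m \<in> Poly_Mapping.keys P"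
      using that eq by (metis (mono_tags, lifting) Pair_inject image_iff)
    ultimately show "Poly_Mapping.lookup P m = Poly_Mapping.lookup Q m"
      by (metis in_keys_iff)
  qed
  moreover have "countable (range ?g)"
    by (rule countable_subset[OF _ fin]) auto
  ultimately show ?thesis by (rule countable_image_inj_on[rotated])
qed

text \<open>Collecting the powers of \<open>x i\<close> turns a nonzero polynomial into a nonzero univariate
  polynomial whose coefficients do not vanish identically at an independent point.\<close>

lemma finite_roots_extension:
  fixes x :: "'i::finite \<Rightarrow> real"
  assumes x: "alg_independent_over_rat x I" and i: "i \<notin> I"
    and P: "P \<noteq> 0" "\<forall>m\<in>Poly_Mapping.keys P. Poly_Mapping.keys m \<subseteq> insert i I"
  shows "finite {t. eval_mpoly (x(i := t)) P = 0}"
proof -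
  define rest where "rest m = Poly_Mapping.update i 0 m" for m :: "'i \<Rightarrow>\<^sub>0 nat"
  define M where "M k = {m \<in> Poly_Mapping.keys P. Poly_Mapping.lookup m i = k}" for k
  define C where "C k = (\<Sum>m\<in>M k. Poly_Mapping.single (rest m) (Poly_Mapping.lookup P m))" for k
  have fM: "finite (M k)" for k by (simp add: M_def)
  have mon: "monom_eval (x(i := t)) m = monom_eval x (rest m) * t ^ k" if "m \<in> M k" for m k t
  proof -
    have "monom_eval (x(i := t)) m = t ^ k * (\<Prod>j\<in>UNIV - {i}. x j ^ Poly_Mapping.lookup m j)"
      using that by (simp add: monom_eval_UNIV prod.remove[of UNIV i] M_def)
    moreover have "monom_eval x (rest m) = (\<Prod>j\<in>UNIV - {i}. x j ^ Poly_Mapping.lookup m j)"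
      by (simp add: monom_eval_UNIV prod.remove[of UNIV i] rest_def lookup_update)
    ultimately show ?thesis by simp
  qed
  define N where "N = Max (insert 0 ((\<lambda>m. Poly_Mapping.lookup m i) ` Poly_Mapping.keys P))"
  have N: "Poly_Mapping.lookup m i \<le> N" if "m \<in> Poly_Mapping.keys P" for m
    unfolding N_def using that by (intro Max_ge) auto
  have ev: "eval_mpoly (x(i := t)) P = (\<Sum>k\<le>N. eval_mpoly x (C k) * t ^ k)" for t
  proof -
    have "(\<Sum>k\<le>N. eval_mpoly x (C k) * t ^ k) =
        (\<Sum>k\<le>N. \<Sum>m\<in>M k. of_rat (Poly_Mapping.lookup P m) * monom_eval (x(i := t)) m)"
      by (intro sum.cong) (auto simp: C_def eval_mpoly_sum sum_distrib_right sum_distrib_left mon mult_ac)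
    also have "\<dots> = (\<Sum>m\<in>Poly_Mapping.keys P. of_rat (Poly_Mapping.lookup P m) * monom_eval (x(i := t)) m)"
      unfolding M_def by (rule sum.group) (auto intro: N)
    finally show ?thesis by (simp add: eval_mpoly_def monom_eval_def)
  qed
  obtain m where m: "m \<in> Poly_Mapping.keys P" using P(1) by fastforce
  define k where "k = Poly_Mapping.lookup m i"
  have "C k \<noteq> 0"
  proof
    assume "C k = 0"
    \<comment> \<open>Among monomials with the same exponent \<open>k\<close> at \<open>i\<close>,
      erasing that exponent loses nothing. Hence no terms merge in \<open>C k\<close>, and its
      coefficient at \<open>rest m\<close> is that of \<open>P\<close> at \<open>m\<close>.\<close>
    have inj: "n = m" if "n \<in> M k" "rest n = rest m" for n
    proof (rule poly_mapping_eqI)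
      fix j
      have "Poly_Mapping.lookup (rest n) j = Poly_Mapping.lookup (rest m) j" using that by simp
      then show "Poly_Mapping.lookup n j = Poly_Mapping.lookup m j"
        using that(1) by (cases "j = i") (auto simp: rest_def lookup_update M_def k_def)
    qed
    have "Poly_Mapping.lookup (C k) (rest m) =
        (\<Sum>n\<in>M k. if n = m then Poly_Mapping.lookup P n else 0)"
      unfolding C_def lookup_sum
      by (rule sum.cong) (auto simp: lookup_single when_def dest: inj)
    also have "\<dots> = Poly_Mapping.lookup P m" using m fM by (simp add: M_def k_def)
    finally show False using \<open>C k = 0\<close> m by (simp add: in_keys_iff)
  qed
  moreover have "Poly_Mapping.keys m' \<subseteq> I" if m': "m' \<in> Poly_Mapping.keys (C k)" for m'
  proof -
    obtain n where "n \<in> M k" "m' = rest n"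
      using m' subsetD[OF Poly_Mapping.keys_sum] unfolding C_def
      by (fastforce split: if_splits)
    moreover from this have "Poly_Mapping.keys n \<subseteq> insert i I" using P(2) by (simp add: M_def)
    ultimately show ?thesis by (auto simp: rest_def keys_update)
  qed
  ultimately have "eval_mpoly x (C k) \<noteq> 0" using x unfolding alg_independent_over_rat_def by blast
  moreover have "k \<le> N" using N m by (simp add: k_def)
  ultimately show ?thesis unfolding ev using polyfun_finite_roots[of "\<lambda>k. eval_mpoly x (C k)" N] by blast
qed

text \<open>Coordinates are chosen one at a time. Each of the countably many polynomials excludes
  finitely many values of the next coordinate, and the reals are uncountable.\<close>

lemma alg_independent_exists: "\<exists>x :: 'i::finite \<Rightarrow> real. alg_independent_over_rat x I"
proof -
  have "finite I" by simp
  then show ?thesis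
  proof (induction I)
    case empty
    have "eval_mpoly (\<lambda>_. 0) P \<noteq> 0" if "P \<noteq> 0" "\<forall>m\<in>Poly_Mapping.keys P. Poly_Mapping.keys m \<subseteq> {}" for P :: "('i \<Rightarrow>\<^sub>0 nat) \<Rightarrow>\<^sub>0 rat"
    proof -
      have "Poly_Mapping.keys P \<subseteq> {0}" using that(2) by auto
      moreover have "Poly_Mapping.keys P \<noteq> {}" using that(1) by simp
      ultimately have "Poly_Mapping.keys P = {0}" by blast
      then show ?thesis by (auto simp: eval_mpoly_def in_keys_iff)
    qed
    then show ?case unfolding alg_independent_over_rat_def by blast
  next
    case (insert i I)
    then obtain x :: "'i \<Rightarrow> real" where x: "alg_independent_over_rat x I" by blast
    define \<P> where "\<P> = {P :: ('i \<Rightarrow>\<^sub>0 nat) \<Rightarrow>\<^sub>0 rat. P \<noteq> 0 \<and> (\<forall>m\<in>Poly_Mapping.keys P. Poly_Mapping.keys m \<subseteq> insert i I)}"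
    have "countable (\<Union>P\<in>\<P>. {t. eval_mpoly (x(i := t)) P = 0})"
      using countable_subset[OF subset_UNIV countable_mpoly] finite_roots_extension[OF x insert(2)]
      by (intro countable_UN) (auto simp: \<P>_def intro: countable_finite)
    then obtain t where "t \<notin> (\<Union>P\<in>\<P>. {t. eval_mpoly (x(i := t)) P = 0})"
      using uncountable_UNIV_real by (metis UNIV_eq_I)
    then have "alg_independent_over_rat (x(i := t)) (insert i I)"
      unfolding alg_independent_over_rat_def by (auto simp: \<P>_def)
    then show ?case by blast
  qed
qed

lemma generic_exists: "\<exists>p :: 'v::finite \<Rightarrow> real^2. generic V p"
proof -
  obtain x :: "'v \<times> 2 \<Rightarrow> real" where x: "alg_independent_over_rat x (V \<times> UNIV)"
    using alg_independent_exists by blast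
  have "(\<lambda>(v, i). (\<lambda>v. \<chi> i. x (v, i)) v $ i) = x" by auto
  then show ?thesis unfolding generic_def using x by metis
qed

section \<open>Rigidity matrices of plane frameworks\<close>

definition cross2 :: "real^2 \<Rightarrow> real^2 \<Rightarrow> real" where
  "cross2 a b = a $ 1 * b $ 2 - a $ 2 * b $ 1"

text \<open>Twice the signed area of the triangle; it vanishes exactly when the three points are
  collinear.\<close>

definition area :: "real^2 \<Rightarrow> real^2 \<Rightarrow> real^2 \<Rightarrow> real" where
  "area a b c = cross2 (b - a) (c - a)"

text \<open>The six points lie on a conic iff this polynomial vanishes.\<close>

definition conic_det :: "real^2 \<Rightarrow> real^2 \<Rightarrow> real^2 \<Rightarrow> real^2 \<Rightarrow> real^2 \<Rightarrow> real^2 \<Rightarrow> real" where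
  "conic_det a1 a2 a3 b1 b2 b3 =
     area b1 a2 a3 * area a1 b3 b1 * area b2 a3 a1 * area a2 b2 b3 -
     area b1 a3 a1 * area a2 b3 b1 * area b2 a2 a3 * area a1 b2 b3"

lemma cross2_eq_zeroD:
  assumes "cross2 x y = 0" "y \<noteq> 0"
  shows "\<exists>t. x = t *\<^sub>R y"
proof (cases "y $ 1 = 0")
  case True
  then have "y $ 2 \<noteq> 0" using assms(2) by (auto simp: vec_eq_iff forall_2)
  then show ?thesis using assms(1) True
    by (intro exI[of _ "x $ 2 / y $ 2"]) (auto simp: vec_eq_iff forall_2 cross2_def)
next
  case False
  then show ?thesis using assms(1)
    by (intro exI[of _ "x $ 1 / y $ 1"]) (auto simp: vec_eq_iff forall_2 cross2_def field_simps)
qed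

lemma cross2_basis:
  assumes "cross2 y z \<noteq> 0"
  shows "\<exists>s t. x = s *\<^sub>R y + t *\<^sub>R z"
proof -
  \<comment> \<open>The coefficients are those of Cramer's rule.\<close>
  have "x $ 1 = cross2 x z / cross2 y z * y $ 1 + cross2 y x / cross2 y z * z $ 1"
    using assms by (simp add: divide_simps) (simp add: cross2_def algebra_simps)
  moreover have "x $ 2 = cross2 x z / cross2 y z * y $ 2 + cross2 y x / cross2 y z * z $ 2"
    using assms by (simp add: divide_simps) (simp add: cross2_def algebra_simps)
  ultimately have "x = (cross2 x z / cross2 y z) *\<^sub>R y + (cross2 y x / cross2 y z) *\<^sub>R z"
    by (simp add: vec_eq_iff forall_2)
  then show ?thesis by blast
qed

lemma cross2_linear:
  "cross2 (x + y) z = cross2 x z + cross2 y z" "cross2 (x - y) z = cross2 x z - cross2 y z"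
  "cross2 (r *\<^sub>R x) z = r * cross2 x z" "cross2 0 z = 0"
  by (simp_all add: cross2_def algebra_simps)

section \<open>Rows of the rigidity matrix as loads in equilibrium\<close>

definition rigidity_rows :: "('v::finite \<Rightarrow> real^2) \<Rightarrow> 'v set set \<Rightarrow> ((real^2)^'v) set" where
  "rigidity_rows p D = {rigidity_row p x y | x y. {x, y} \<in> D}"

text \<open>Systems of forces at the joints in \<open>W\<close> with zero resultant and zero total
  moment. The space contains the rows of all bars inside \<open>W\<close>, which bounds both ranks
  and intersections of row spaces from above.\<close>

definition equilibrium_loads :: "('v::finite \<Rightarrow> real^2) \<Rightarrow> 'v set \<Rightarrow> ((real^2)^'v) set" where
  "equilibrium_loads p W =
     {f. (\<forall>v. v \<notin> W \<longrightarrow> f $ v = 0) \<and> (\<Sum>v\<in>UNIV. f $ v) = 0 \<and> (\<Sum>v\<in>UNIV. cross2 (f $ v) (p v)) = 0}"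

lemma rigidity_rows_mono: "D \<subseteq> D' \<Longrightarrow> rigidity_rows p D \<subseteq> rigidity_rows p D'"
  unfolding rigidity_rows_def by blast

lemma subspace_equilibrium_loads: "subspace (equilibrium_loads p W)"
  unfolding equilibrium_loads_def subspace_def
  by (auto simp: cross2_linear sum.distrib simp flip: scaleR_sum_right sum_distrib_left)

text \<open>A bar pushes its two ends with opposite forces along its own line, so the resultant and
  the moment cancel.\<close>

lemma rigidity_row_equilibrium:
  assumes "x \<noteq> y" "x \<in> W" "y \<in> W"
  shows "rigidity_row p x y \<in> equilibrium_loads p W"
proof -
  let ?w = "p x - p y"
  have eq: "rigidity_row p x y $ v = (if v = x then ?w else 0) - (if v = y then ?w else 0)" for v
    using assms by (auto simp: rigidity_row_def)
  have cr: "cross2 (rigidity_row p x y $ v) (p v) =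
      (if v = x then cross2 ?w (p v) else 0) - (if v = y then cross2 ?w (p v) else 0)" for v
    by (auto simp: eq cross2_linear)
  have "(\<Sum>v\<in>UNIV. rigidity_row p x y $ v) = 0"
    by (simp add: eq sum_subtractf)
  moreover have "(\<Sum>v\<in>UNIV. cross2 (rigidity_row p x y $ v) (p v)) = 0"
    by (simp add: cr sum_subtractf) (simp add: cross2_def algebra_simps)
  ultimately show ?thesis using assms by (auto simp: equilibrium_loads_def rigidity_row_def)
qed

text \<open>Two forces with zero resultant are opposite; zero moment then makes them parallel to the
  line through their points of application.\<close>

lemma equilibrium_loads_pair:
  assumes "a \<noteq> b" "p a \<noteq> p b" "f \<in> equilibrium_loads p {a, b}"
  shows "f \<in> span {rigidity_row p a b}"
proof -
  have supp: "f $ v = 0" if "v \<noteq> a" "v \<noteq> b" for v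
    using assms(3) that by (auto simp: equilibrium_loads_def)
  have "(\<Sum>v\<in>UNIV. f $ v) = (\<Sum>v\<in>{a, b}. f $ v)"
    by (rule sum.mono_neutral_right) (auto simp: supp)
  then have 1: "f $ b = - (f $ a)"
    using assms by (simp add: equilibrium_loads_def eq_neg_iff_add_eq_0 add.commute)
  have "(\<Sum>v\<in>UNIV. cross2 (f $ v) (p v)) = (\<Sum>v\<in>{a, b}. cross2 (f $ v) (p v))"
    by (rule sum.mono_neutral_right) (auto simp: supp cross2_linear)
  then have "cross2 (f $ a) (p a - p b) = 0"
    using assms 1 by (simp add: equilibrium_loads_def) (simp add: cross2_def algebra_simps)
  then obtain t where "f $ a = t *\<^sub>R (p a - p b)"
    using cross2_eq_zeroD assms(2) by (metis eq_iff_diff_eq_0)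
  then have "f = t *\<^sub>R rigidity_row p a b"
    using 1 supp assms(1) by (auto simp: vec_eq_iff rigidity_row_def algebra_simps)
  then show ?thesis by (simp add: span_base span_mul)
qed

lemma K33_stress_zero:
  fixes a b :: "3 \<Rightarrow> real^2" and \<omega> :: "3 \<Rightarrow> 3 \<Rightarrow> real"
  assumes row_eq: "\<And>i. (\<Sum>j\<in>UNIV. \<omega> i j *\<^sub>R (a i - b j)) = 0"
    and col_eq: "\<And>j. (\<Sum>i\<in>UNIV. \<omega> i j *\<^sub>R (b j - a i)) = 0"
    and nz: "\<And>i j k. j \<noteq> k \<Longrightarrow> area (a i) (b j) (b k) \<noteq> 0" "\<And>i j k. j \<noteq> k \<Longrightarrow> area (b i) (a j) (a k) \<noteq> 0"
    and conic: "conic_det (a 1) (a 2) (a 3) (b 1) (b 2) (b 3) \<noteq> 0"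
  shows "\<omega> i j = 0"
proof -
  \<comment> \<open>Three weighted vectors in the plane sum to zero iff the weights are proportional to their
    pairwise cross products; chaining the row and column relations gives the conic.\<close>
  have R: "\<omega> i j * area (a i) (b j) (b k) + \<omega> i l * area (a i) (b l) (b k) = 0"
    if "UNIV = {j, k, l}" "distinct [j, k, l]" for i j k l
  proof -
    have *: "(\<Sum>j\<in>UNIV. \<omega> i j *\<^sub>R (a i - b j)) = \<omega> i j *\<^sub>R (a i - b j) + \<omega> i k *\<^sub>R (a i - b k) + \<omega> i l *\<^sub>R (a i - b l)"
      unfolding that(1) using that(2) by simp
    have "cross2 (\<Sum>j\<in>UNIV. \<omega> i j *\<^sub>R (a i - b j)) (a i - b k) = 0"
      by (simp add: row_eq cross2_linear)
    then show ?thesis unfolding * cross2_linear by (simp add: area_def cross2_def algebra_simps)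
  qed
  have C: "\<omega> i j * area (b j) (a i) (a k) + \<omega> l j * area (b j) (a l) (a k) = 0"
    if "UNIV = {i, k, l}" "distinct [i, k, l]" for i j k l
  proof -
    have *: "(\<Sum>i\<in>UNIV. \<omega> i j *\<^sub>R (b j - a i)) = \<omega> i j *\<^sub>R (b j - a i) + \<omega> k j *\<^sub>R (b j - a k) + \<omega> l j *\<^sub>R (b j - a l)"
      unfolding that(1) using that(2) by simp
    have "cross2 (\<Sum>i\<in>UNIV. \<omega> i j *\<^sub>R (b j - a i)) (b j - a k) = 0"
      by (simp add: col_eq cross2_linear)
    then show ?thesis unfolding * cross2_linear by (simp add: area_def cross2_def algebra_simps)
  qed
  have anti: "area x y z = - area x z y" for x y z by (simp add: area_def cross2_def)
  have U: "UNIV = {1, 2, 3 :: 3}" "UNIV = {1, 3, 2 :: 3}" "distinct [1, 3, 2 :: 3]"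
    using UNIV_3 by auto
  \<comment> \<open>These four relations lead around the cycle of entries 12, 11, 21, 22 and back to
    12. The two products of areas collected on the way are the two terms of
    \<open>conic_det\<close>.\<close>
  have r1: "\<omega> 1 1 * area (a 1) (b 3) (b 1) = \<omega> 1 2 * area (a 1) (b 2) (b 3)"
    using R[of 1 3 2 1] U anti[of "a 1" "b 1" "b 3"] by simp
  have r2: "\<omega> 2 1 * area (a 2) (b 3) (b 1) = \<omega> 2 2 * area (a 2) (b 2) (b 3)"
    using R[of 1 3 2 2] U anti[of "a 2" "b 1" "b 3"] by simp
  have c1: "\<omega> 1 1 * area (b 1) (a 3) (a 1) = \<omega> 2 1 * area (b 1) (a 2) (a 3)"
    using C[of 1 3 2 1] U anti[of "b 1" "a 1" "a 3"] by simp
  have c2: "\<omega> 1 2 * area (b 2) (a 3) (a 1) = \<omega> 2 2 * area (b 2) (a 2) (a 3)"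
    using C[of 1 3 2 2] U anti[of "b 2" "a 1" "a 3"] by simp
  have "\<omega> 1 2 * conic_det (a 1) (a 2) (a 3) (b 1) (b 2) (b 3) = 0"
    using r1 r2 c1 c2 unfolding conic_det_def by algebra
  then have "\<omega> 1 2 = 0" using conic by simp
  have third: "\<exists>l. UNIV = {j, l, k} \<and> distinct [j, l, k]" if "j \<noteq> k" for j k :: 3
  proof -
    have "card {j, k} \<noteq> card (UNIV :: 3 set)" using that by simp
    then obtain l where l: "l \<noteq> j" "l \<noteq> k" by (metis UNIV_eq_I insertCI)
    then have "card {j, l, k} = card (UNIV :: 3 set)" using that by simp
    then have "{j, l, k} = UNIV" by (intro card_subset_eq) auto
    then show ?thesis using l that by auto
  qed
  \<comment> \<open>One zero entry spreads: a row relation has two terms once the third column is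
    crossed out, and nonvanishing areas pass the zero on. The same along columns then reaches every
    entry.\<close>
  have row: "\<omega> i j = 0" if "\<omega> i k = 0" for i j k
  proof (cases "j = k")
    case False
    from third[OF this] obtain l where l: "UNIV = {j, l, k}" "distinct [j, l, k]" by blast
    then show ?thesis using R[OF l, of i] that nz(1)[of j l i] by simp
  qed (use that in simp)
  have col: "\<omega> i j = 0" if "\<omega> k j = 0" for i j k
  proof (cases "i = k")
    case False
    from third[OF this] obtain l where l: "UNIV = {i, l, k}" "distinct [i, l, k]" by blast
    then show ?thesis using C[OF l, of j] that nz(2)[of i l j] by simp
  qed (use that in simp)
  show ?thesis using col[OF row[OF \<open>\<omega> 1 2 = 0\<close>]] .
qed

text \<open>Genericity enters the rank arguments through these three conditions on the points of
  \<open>V\<close>. A set \<open>W\<close> of vertices stands for the subgraph it induces, a class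
  closed under deleting vertices and under taking sides of a separation.\<close>

locale plane_framework =
  fixes E :: "'v::finite set set" and p :: "'v \<Rightarrow> real^2" and V :: "'v set"
  assumes card_edge: "e \<in> E \<Longrightarrow> card e = 2"
    and inj_p: "inj_on p V"
    and noncollinear: "\<lbrakk>a \<in> V; b \<in> V; c \<in> V; distinct [a, b, c]\<rbrakk> \<Longrightarrow> area (p a) (p b) (p c) \<noteq> 0"
    and nonconic: "\<lbrakk>set [a1, a2, a3, b1, b2, b3] \<subseteq> V; distinct [a1, a2, a3, b1, b2, b3]\<rbrakk> \<Longrightarrow>
      conic_det (p a1) (p a2) (p a3) (p b1) (p b2) (p b3) \<noteq> 0"
begin

definition edges_in :: "'v set \<Rightarrow> 'v set set" where
  "edges_in W = {e \<in> E. e \<subseteq> W}"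

text \<open>The vertex \<open>v\<close> may lie outside \<open>W\<close>: the arguments also count
  how many neighbours a deleted vertex has in what is left.\<close>

definition nbrs :: "'v set \<Rightarrow> 'v \<Rightarrow> 'v set" where
  "nbrs W v = {y \<in> W. {v, y} \<in> E}"

definition deg :: "'v set \<Rightarrow> 'v \<Rightarrow> nat" where
  "deg W v = card (nbrs W v)"

text \<open>The corank of the induced edges in the row matroid, that is, the dimension of the space
  of self-stresses.\<close>

definition nullity :: "'v set \<Rightarrow> int" where
  "nullity W = int (card (edges_in W)) - int (dim (rigidity_rows p (edges_in W)))"

section \<open>Rank arguments: vertex deletion, gluing, the bound 2n - 3, and K_{3,3}\<close>

lemma edge_neq: "{x, y} \<in> E \<Longrightarrow> x \<noteq> y"
  using card_edge by fastforce

lemma nbrs_irrefl: "v \<notin> nbrs W v"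
  using edge_neq[of v v] by (auto simp: nbrs_def)

lemma edges_in_mono: "W \<subseteq> W' \<Longrightarrow> edges_in W \<subseteq> edges_in W'"
  by (auto simp: edges_in_def)

lemma rows_equilibrium: "rigidity_rows p (edges_in W) \<subseteq> equilibrium_loads p W"
proof
  fix f assume "f \<in> rigidity_rows p (edges_in W)"
  then obtain x y where "f = rigidity_row p x y" "{x, y} \<in> E" "x \<in> W" "y \<in> W"
    by (auto simp: rigidity_rows_def edges_in_def)
  then show "f \<in> equilibrium_loads p W"
    using rigidity_row_equilibrium edge_neq by blast
qed

lemma edges_in_remove:
  assumes "v \<in> W"
  shows "edges_in W = edges_in (W - {v}) \<union> (\<lambda>y. {v, y}) ` nbrs W v"
proof -
  have "\<exists>y. y \<in> W \<and> e = {v, y}" if "e \<in> E" "e \<subseteq> W" "v \<in> e" for e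
    using card_edge[OF that(1)] that by (auto simp: card_2_iff insert_commute)
  then show ?thesis using assms by (fastforce simp: edges_in_def nbrs_def)
qed

lemma card_edges_in_remove:
  assumes "v \<in> W"
  shows "card (edges_in W) = card (edges_in (W - {v})) + deg W v"
proof -
  have "inj_on (\<lambda>y. {v, y}) (nbrs W v)"
    by (auto simp: inj_on_def doubleton_eq_iff)
  then have "card ((\<lambda>y. {v, y}) ` nbrs W v) = deg W v"
    by (simp add: deg_def card_image)
  moreover have "edges_in (W - {v}) \<inter> (\<lambda>y. {v, y}) ` nbrs W v = {}"
    by (auto simp: edges_in_def)
  ultimately show ?thesis
    by (simp add: edges_in_remove[OF assms] card_Un_disjoint)
qed

text \<open>Rows of edges avoiding \<open>v\<close> vanish in the block of \<open>v\<close>. Two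
  rows at \<open>v\<close> have independent blocks there, since \<open>v\<close> and two neighbours
  are not collinear, so adding \<open>v\<close> raises the rank by at least the minimum of 2 and its
  degree.\<close>

lemma nullity_remove:
  assumes "v \<in> W" "W \<subseteq> V"
  shows "deg W v \<ge> 2 \<Longrightarrow> nullity W \<le> nullity (W - {v}) + (int (deg W v) - 2)"
    and "deg W v \<le> 2 \<Longrightarrow> nullity W \<le> nullity (W - {v})"
proof -
  let ?U = "rigidity_rows p (edges_in (W - {v}))" and ?R = "rigidity_rows p (edges_in W)"
  have sub: "?U \<subseteq> ?R" by (intro rigidity_rows_mono edges_in_mono) auto
  have nbr: "rigidity_row p v y \<in> ?R" "y \<noteq> v" "y \<in> V" if "y \<in> nbrs W v" for y
    using that assms nbrs_irrefl by (auto simp: rigidity_rows_def edges_in_def nbrs_def)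
  have supp: "f $ v = 0" if "f \<in> span ?U" for f
    using that span_minimal[OF rows_equilibrium subspace_equilibrium_loads, of "W - {v}"]
    by (auto simp: equilibrium_loads_def)
  have d1: "dim ?U + 1 = dim (insert (rigidity_row p v y) ?U)" if "y \<in> nbrs W v" for y
  proof -
    have "p v \<noteq> p y" using nbr[OF that] assms inj_onD[OF inj_p, of v y] by blast
    then have "rigidity_row p v y \<notin> span ?U"
      using supp[of "rigidity_row p v y"] by (auto simp: rigidity_row_def)
    then show ?thesis by (simp add: dim_insert)
  qed
  have d2: "dim ?U + 2 = dim (insert (rigidity_row p v z) (insert (rigidity_row p v y) ?U))"
    if yz: "y \<in> nbrs W v" "z \<in> nbrs W v" "y \<noteq> z" for y z
  proof -
    have "rigidity_row p v z \<notin> span (insert (rigidity_row p v y) ?U)"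
    proof
      assume "rigidity_row p v z \<in> span (insert (rigidity_row p v y) ?U)"
      then obtain k where "rigidity_row p v z - k *\<^sub>R rigidity_row p v y \<in> span ?U"
        using span_breakdown_eq by blast
      from supp[OF this] have "p v - p z = k *\<^sub>R (p v - p y)"
        by (simp add: rigidity_row_def)
      then have "p z - p v = k *\<^sub>R (p y - p v)"
        by (metis minus_diff_eq scaleR_minus_right)
      then have "area (p v) (p y) (p z) = 0"
        by (simp add: area_def cross2_def)
      then show False using noncollinear[of v y z] nbr(2,3)[OF yz(1)] nbr(2,3)[OF yz(2)] assms yz(3) by auto
    qed
    then show ?thesis using d1[OF yz(1)] by (simp add: dim_insert)
  qed
  have le: "dim A \<le> dim ?R" if "A \<subseteq> ?R" for A using that by (rule dim_subset)
  have min: "dim ?U + min 2 (deg W v) \<le> dim ?R"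
  proof (cases "deg W v \<ge> 2")
    case True
    then obtain T where "T \<subseteq> nbrs W v" "card T = 2"
      unfolding deg_def by (meson obtain_subset_with_card_n)
    then obtain y z where "y \<in> nbrs W v" "z \<in> nbrs W v" "y \<noteq> z"
      unfolding card_2_iff by blast
    with le[of "insert (rigidity_row p v z) (insert (rigidity_row p v y) ?U)"] d2 nbr(1) sub True
    show ?thesis by (metis insert_subset min.absorb1)
  next
    case False
    then consider "deg W v = 0" | "deg W v = 1" by linarith
    then show ?thesis
    proof cases
      case 2
      then obtain y where "nbrs W v = {y}" unfolding deg_def by (rule card_1_singletonE)
      with le[of "insert (rigidity_row p v y) ?U"] d1[of y] nbr(1)[of y] sub 2
      show ?thesis by simp
    qed (use le[OF sub] in simp)
  qed
  then show "deg W v \<ge> 2 \<Longrightarrow> nullity W \<le> nullity (W - {v}) + (int (deg W v) - 2)"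
    and "deg W v \<le> 2 \<Longrightarrow> nullity W \<le> nullity (W - {v})"
    using card_edges_in_remove[OF assms(1)] by (auto simp: nullity_def)
qed

text \<open>The row spaces of the two sides meet only in loads carried by \<open>a\<close> and
  \<open>b\<close>, which form at most a line; hence the ranks add up with a loss of at most 1. The
  second unit pays for the edge \<open>e\<close>, whose row may be dependent.\<close>

lemma nullity_gluing:
  assumes "W1 \<inter> W2 \<subseteq> {a, b}" "a \<noteq> b" "a \<in> V" "b \<in> V"
    and W: "W1 \<union> W2 = W" and edges: "edges_in W \<subseteq> insert e (edges_in W1 \<union> edges_in W2)"
  shows "nullity W \<le> nullity W1 + nullity W2 + 2"
proof -
  let ?S = "\<lambda>W. span (rigidity_rows p (edges_in W))"
  have eq: "?S W' \<subseteq> equilibrium_loads p W'" for W'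
    using rows_equilibrium subspace_equilibrium_loads span_minimal by blast
  have ab: "p a \<noteq> p b" using assms inj_onD[OF inj_p] by blast
  have "?S W1 \<inter> ?S W2 \<subseteq> equilibrium_loads p {a, b}"
    using eq[of W1] eq[of W2] assms(1) unfolding equilibrium_loads_def by blast
  then have "?S W1 \<inter> ?S W2 \<subseteq> span {rigidity_row p a b}"
    using equilibrium_loads_pair[OF assms(2) ab] by blast
  then have int: "dim (?S W1 \<inter> ?S W2) \<le> 1"
    using dim_le_card[of "?S W1 \<inter> ?S W2" "{rigidity_row p a b}"] by simp
  have "?S W1 \<subseteq> ?S W" "?S W2 \<subseteq> ?S W"
    using W by (auto intro!: span_mono rigidity_rows_mono edges_in_mono)
  then have "{x + y |x y. x \<in> ?S W1 \<and> y \<in> ?S W2} \<subseteq> ?S W"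
    by (auto intro: span_add)
  from dim_subset[OF this] have "dim (rigidity_rows p (edges_in W1)) + dim (rigidity_rows p (edges_in W2)) \<le> dim (rigidity_rows p (edges_in W)) + 1"
    using dim_sums_Int[of "?S W1" "?S W2"] int by simp
  moreover have "card (edges_in W) \<le> card (insert e (edges_in W1 \<union> edges_in W2))"
    by (rule card_mono[OF _ edges]) simp
  then have "card (edges_in W) \<le> card (edges_in W1) + card (edges_in W2) + 1"
    using card_Un_le[of "edges_in W1" "edges_in W2"] by (simp add: card_insert_if split: if_splits)
  ultimately show ?thesis unfolding nullity_def by linarith
qed

text \<open>A fixed bar \<open>ab\<close> together with the bars from every other point to
  \<open>a\<close> and to \<open>b\<close> spans all equilibrium loads: the force at each other
  point is resolved along its two bars, and what remains sits on \<open>a\<close> and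
  \<open>b\<close>. Their number is 1 + 2(n - 2).\<close>

lemma dim_equilibrium_loads:
  assumes "W \<subseteq> V" "card W \<ge> 2"
  shows "int (dim (equilibrium_loads p W)) \<le> 2 * int (card W) - 3"
proof -
  obtain T where "T \<subseteq> W" "card T = 2" using assms(2) by (meson obtain_subset_with_card_n)
  then obtain a b where ab: "a \<in> W" "b \<in> W" "a \<noteq> b" unfolding card_2_iff by blast
  let ?X = "W - {a, b}"
  let ?r = "rigidity_row p"
  let ?B = "insert (?r a b) ((\<lambda>v. ?r v a) ` ?X \<union> (\<lambda>v. ?r v b) ` ?X)"
  have "f \<in> span ?B" if f: "f \<in> equilibrium_loads p W" for f
  proof -
    have "\<exists>s t. f $ v = s *\<^sub>R (p v - p a) + t *\<^sub>R (p v - p b)" if "v \<in> ?X" for v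
    proof (rule cross2_basis)
      have "area (p v) (p a) (p b) \<noteq> 0" using that ab assms by (intro noncollinear) auto
      then show "cross2 (p v - p a) (p v - p b) \<noteq> 0" by (simp add: area_def cross2_def algebra_simps)
    qed
    then obtain s t where st: "\<And>v. v \<in> ?X \<Longrightarrow> f $ v = s v *\<^sub>R (p v - p a) + t v *\<^sub>R (p v - p b)"
      by metis
    define h where "h = (\<Sum>v\<in>?X. s v *\<^sub>R ?r v a + t v *\<^sub>R ?r v b)"
    have hB: "h \<in> span ?B" unfolding h_def
      by (intro span_sum span_add span_mul span_base) auto
    have "h \<in> equilibrium_loads p W" unfolding h_def
      using ab by (intro subspace_sum subspace_add subspace_mul subspace_equilibrium_loads
          rigidity_row_equilibrium) auto
    then have fh: "f - h \<in> equilibrium_loads p W"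
      by (intro subspace_diff[OF subspace_equilibrium_loads] f)
    have "h $ u = f $ u" if u: "u \<in> ?X" for u
    proof -
      have "h $ u = (\<Sum>v\<in>?X. if v = u then f $ u else 0)"
        unfolding h_def sum_component
        by (rule sum.cong) (use u st[OF u] in \<open>auto simp: rigidity_row_def\<close>)
      then show ?thesis using u by simp
    qed
    then have "f - h \<in> equilibrium_loads p {a, b}"
      using fh unfolding equilibrium_loads_def by fastforce
    then have "f - h \<in> span {?r a b}"
      using ab assms inj_onD[OF inj_p, of a b] by (intro equilibrium_loads_pair) auto
    then have "f - h \<in> span ?B" using span_mono[of "{?r a b}" ?B] by blast
    from span_add[OF this hB] show ?thesis by simp
  qed
  then have "dim (equilibrium_loads p W) \<le> card ?B" by (intro dim_le_card) auto
  also have "\<dots> \<le> Suc (card ((\<lambda>v. ?r v a) ` ?X \<union> (\<lambda>v. ?r v b) ` ?X))"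
    by (simp add: card_insert_if)
  also have "\<dots> \<le> Suc (card ?X + card ?X)"
    using card_Un_le card_image_le[of ?X] by (meson Suc_le_mono add_mono finite le_trans)
  also have "card ?X = card W - 2" using ab by (simp add: card_Diff_subset)
  finally show ?thesis using assms(2) by linarith
qed

text \<open>The map \<open>f\<close>, taking a 3 by 3 matrix of weights to the weighted sum of the
  nine rows, is injective: its blocks at the vertices \<open>a k\<close> and \<open>b k\<close> are
  the row and column relations of \<open>K33_stress_zero\<close>. So the rank is 9, the number of
  edges.\<close>

lemma nullity_K33:
  assumes A: "A \<subseteq> V" "card A = 3" and B: "B \<subseteq> V" "card B = 3" and disj: "A \<inter> B = {}"
    and edges: "edges_in (A \<union> B) = {{a, b} | a b. a \<in> A \<and> b \<in> B}"
  shows "nullity (A \<union> B) \<le> 0"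
proof -
  have "\<exists>f :: 3 \<Rightarrow> 'v. bij_betw f UNIV X" if "card X = 3" for X :: "'v set"
    using that by (intro finite_same_card_bij) auto
  then obtain a b :: "3 \<Rightarrow> 'v" where a: "bij_betw a UNIV A" and b: "bij_betw b UNIV B"
    using A B by metis
  have aA: "a i \<in> A" and bB: "b i \<in> B" for i using a b by (auto simp: bij_betw_def)
  have a_eq: "a i = a j \<longleftrightarrow> i = j" and b_eq: "b i = b j \<longleftrightarrow> i = j" for i j
    using a b by (auto simp: bij_betw_def inj_on_def)
  have ab: "a i \<noteq> b j" for i j using aA[of i] bB[of j] disj by auto
  define f :: "real^3^3 \<Rightarrow> (real^2)^'v" where
    "f \<omega> = (\<Sum>i\<in>UNIV. \<Sum>j\<in>UNIV. \<omega> $ i $ j *\<^sub>R rigidity_row p (a i) (b j))" for \<omega>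
  have lin: "linear f"
    by (rule linearI) (simp_all add: f_def scaleR_add_left sum.distrib scaleR_sum_right)
  have "\<omega> = 0" if "f \<omega> = 0" for \<omega>
  proof -
    have fa: "f \<omega> $ a k = (\<Sum>j\<in>UNIV. \<omega> $ k $ j *\<^sub>R (p (a k) - p (b j)))" for k
    proof -
      have "f \<omega> $ a k = (\<Sum>i\<in>UNIV. if i = k then \<Sum>j\<in>UNIV. \<omega> $ k $ j *\<^sub>R (p (a k) - p (b j)) else 0)"
        unfolding f_def sum_component
        by (rule sum.cong) (auto simp: rigidity_row_def a_eq ab sum_component)
      then show ?thesis by simp
    qed
    have fb: "f \<omega> $ b k = (\<Sum>i\<in>UNIV. \<omega> $ i $ k *\<^sub>R (p (b k) - p (a i)))" for k
    proof -
      have "f \<omega> $ b k = (\<Sum>i\<in>UNIV. \<Sum>j\<in>UNIV. if j = k then \<omega> $ i $ k *\<^sub>R (p (b k) - p (a i)) else 0)"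
        unfolding f_def sum_component
        by (intro sum.cong) (auto simp: rigidity_row_def b_eq ab[symmetric] sum_component)
      then show ?thesis by simp
    qed
    have V: "a i \<in> V" "b i \<in> V" for i using aA bB A B by auto
    have "\<omega> $ i $ j = 0" for i j
    proof (rule K33_stress_zero[where a = "\<lambda>i. p (a i)" and b = "\<lambda>j. p (b j)"])
      show "(\<Sum>j\<in>UNIV. \<omega> $ i $ j *\<^sub>R (p (a i) - p (b j))) = 0" for i
        using fa[of i] that by simp
      show "(\<Sum>i\<in>UNIV. \<omega> $ i $ j *\<^sub>R (p (b j) - p (a i))) = 0" for j
        using fb[of j] that by simp
      show "area (p (a i)) (p (b j)) (p (b k)) \<noteq> 0" if "j \<noteq> k" for i j k
        using that V ab by (intro noncollinear) (auto simp: b_eq)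
      show "area (p (b i)) (p (a j)) (p (a k)) \<noteq> 0" if "j \<noteq> k" for i j k
        using that V ab[symmetric] by (intro noncollinear) (auto simp: a_eq)
      show "conic_det (p (a 1)) (p (a 2)) (p (a 3)) (p (b 1)) (p (b 2)) (p (b 3)) \<noteq> 0"
        using V ab by (intro nonconic) (auto simp: a_eq b_eq)
    qed
    then show ?thesis by (simp add: vec_eq_iff)
  qed
  then have "inj f" using lin linear_injective_0 by blast
  then have "dim (range f) = DIM(real^3^3)"
    using dim_image_eq[OF lin] by (simp add: dim_UNIV)
  moreover have "range f \<subseteq> span (rigidity_rows p (edges_in (A \<union> B)))"
  proof -
    have "rigidity_row p (a i) (b j) \<in> rigidity_rows p (edges_in (A \<union> B))" for i j
      unfolding rigidity_rows_def edges using aA bB by blast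
    then show ?thesis unfolding f_def by (fastforce intro: span_sum span_mul span_base)
  qed
  ultimately have "9 \<le> dim (rigidity_rows p (edges_in (A \<union> B)))"
    using dim_subset[of "range f" "span (rigidity_rows p (edges_in (A \<union> B)))"] by simp
  moreover have "edges_in (A \<union> B) \<subseteq> (\<lambda>(a, b). {a, b}) ` (A \<times> B)" unfolding edges by auto
  then have "card (edges_in (A \<union> B)) \<le> card (A \<times> B)" by (meson finite surj_card_le)
  ultimately show ?thesis using A B by (simp add: nullity_def)
qed

end

section \<open>Nullity of graphs with separated edges\<close>

text \<open>The separation is phrased as a tripartition whose only edge between \<open>A\<close> and
  \<open>B\<close> is \<open>uv\<close>. Intersecting the three parts with a smaller vertex set
  keeps every clause, which is also why the cut has at most two vertices and not exactly
  two.\<close>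

locale edge_separated_framework = plane_framework +
  assumes edge_separation: "\<lbrakk>{u, v} \<in> E; u \<in> V; v \<in> V\<rbrakk> \<Longrightarrow>
    \<exists>A S B. V = A \<union> S \<union> B \<and> A \<inter> S = {} \<and> A \<inter> B = {} \<and> S \<inter> B = {} \<and> u \<in> A \<and> v \<in> B \<and> card S \<le> 2 \<and>
      (\<forall>x\<in>A. \<forall>y\<in>B. {x, y} \<in> E \<longrightarrow> x = u \<and> y = v)"
begin

section \<open>Separations of an edge and the configurations they forbid\<close>

definition adj :: "'a \<Rightarrow> 'a \<Rightarrow> bool" where
  "adj x y \<longleftrightarrow> {x, y} \<in> E"

definition clique :: "'a set \<Rightarrow> bool" where
  "clique Q \<longleftrightarrow> (\<forall>x\<in>Q. \<forall>y\<in>Q. x \<noteq> y \<longrightarrow> adj x y)"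

definition separates :: "'a set \<Rightarrow> 'a \<Rightarrow> 'a \<Rightarrow> 'a set \<Rightarrow> 'a set \<Rightarrow> 'a set \<Rightarrow> bool" where
  "separates W u v A S B \<longleftrightarrow> W = A \<union> S \<union> B \<and> A \<inter> S = {} \<and> A \<inter> B = {} \<and> S \<inter> B = {} \<and>
     u \<in> A \<and> v \<in> B \<and> card S \<le> 2 \<and> (\<forall>x\<in>A. \<forall>y\<in>B. adj x y \<longrightarrow> x = u \<and> y = v)"

lemma adj_commute: "adj x y \<longleftrightarrow> adj y x"
  by (simp add: adj_def insert_commute)

lemma adj_neq: "adj x y \<Longrightarrow> x \<noteq> y"
  by (simp add: adj_def edge_neq)

lemma in_nbrs: "y \<in> nbrs W x \<longleftrightarrow> y \<in> W \<and> adj x y"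
  by (simp add: nbrs_def adj_def)

lemma separates_exists:
  assumes "adj u v" "u \<in> W" "v \<in> W" "W \<subseteq> V"
  obtains A S B where "separates W u v A S B"
proof -
  obtain A S B where *: "V = A \<union> S \<union> B" "A \<inter> S = {}" "A \<inter> B = {}" "S \<inter> B = {}" "u \<in> A" "v \<in> B"
      "card S \<le> 2" "\<forall>x\<in>A. \<forall>y\<in>B. {x, y} \<in> E \<longrightarrow> x = u \<and> y = v"
    using edge_separation[OF assms(1)[unfolded adj_def]] subsetD[OF assms(4)] assms(2,3) by auto
  have "card (S \<inter> W) \<le> card S" by (intro card_mono) auto
  then have card: "card (S \<inter> W) \<le> 2" using *(7) by linarith
  have "W = (A \<inter> W) \<union> (S \<inter> W) \<union> (B \<inter> W)" using *(1) assms(4) by blast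
  moreover have "\<forall>x\<in>A \<inter> W. \<forall>y\<in>B \<inter> W. adj x y \<longrightarrow> x = u \<and> y = v"
    using *(8) unfolding adj_def by blast
  ultimately have "separates W u v (A \<inter> W) (S \<inter> W) (B \<inter> W)"
    using *(2-6) assms(2,3) card unfolding separates_def by blast
  then show ?thesis using that by blast
qed

lemma separates_commute:
  assumes "separates W u v A S B"
  shows "separates W v u B S A"
  using assms unfolding separates_def by (auto simp: adj_commute)

lemma separates_cross:
  assumes "separates W u v A S B" "x \<in> A" "y \<in> B" "adj x y"
  shows "x = u" "y = v"
  using assms unfolding separates_def by blast+

lemma separates_partition:
  assumes "separates W u v A S B"
  shows "W = A \<union> S \<union> B" "A \<inter> S = {}" "A \<inter> B = {}" "S \<inter> B = {}" "u \<in> A" "v \<in> B" "card S \<le> 2"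
  using assms by (simp_all only: separates_def)

lemma separates_common_nbr:
  assumes "separates W u v A S B" "adj u c" "adj v c" "c \<in> W"
  shows "c \<in> S"
proof (rule ccontr)
  assume "c \<notin> S"
  then consider "c \<in> A" | "c \<in> B" using assms(4) separates_partition(1)[OF assms(1)] by blast
  then show False
  proof cases
    case 1
    then have "c = u" using separates_cross(1)[OF assms(1) 1, of v] separates_partition(6)[OF assms(1)] assms(3)
      adj_commute by blast
    then show False using assms(2) adj_neq by blast
  next
    case 2
    then have "c = v" using separates_cross(2)[OF assms(1) _ 2, of u] separates_partition(5)[OF assms(1)] assms(2)
      by blast
    then show False using assms(3) adj_neq by blast
  qed
qed

lemma separates_path:
  assumes "separates W u v A S B" "adj u x" "adj x y" "adj y v" "x \<in> W" "y \<in> W" "x \<noteq> v" "y \<noteq> u"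
  shows "x \<in> S \<or> y \<in> S"
proof (rule ccontr)
  assume S: "\<not> ?thesis"
  note part = separates_partition[OF assms(1)]
  have "x \<notin> B" using separates_cross(2)[OF assms(1) part(5)] assms(2,7) by blast
  then have x: "x \<in> A" using S part(1) assms(5) by blast
  have "y \<notin> A" using separates_cross(1)[OF assms(1) _ part(6)] assms(4,8) by blast
  then have "y \<in> B" using S part(1) assms(6) by blast
  then have "x = u" using separates_cross(1)[OF assms(1) x] assms(3) by blast
  then show False using assms(2) adj_neq by blast
qed

text \<open>Besides the edge itself there would be three internally disjoint paths from
  \<open>u\<close> to \<open>v\<close>, and each needs its own vertex in the cut of size at most
  2.\<close>

lemma three_common_nbrs:
  assumes "adj u v" "{u, v, c1, c2, c3} \<subseteq> V"
    and "adj u c1" "adj v c1" "adj u c2" "adj v c2" "adj u c3" "adj v c3"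
    and "distinct [c1, c2, c3]"
  shows False
proof -
  obtain A S B where s: "separates V u v A S B"
    using separates_exists[of u v V] assms(1,2) by auto
  then have "{c1, c2, c3} \<subseteq> S" using separates_common_nbr assms by auto
  then have "card {c1, c2, c3} \<le> card S" by (intro card_mono) auto
  then show False using separates_partition(7)[OF s] assms(9) by simp
qed

text \<open>As with three common neighbours, except that one of the three disjoint paths has length
  three; the cut meets it in \<open>x\<close> or \<open>y\<close>.\<close>

lemma two_common_nbrs_and_path:
  assumes "adj u v" "{u, v, c1, c2, x, y} \<subseteq> V"
    and "adj u c1" "adj v c1" "adj u c2" "adj v c2" "adj u x" "adj x y" "adj y v"
    and "distinct [u, v, c1, c2, x, y]"
  shows False
proof -
  obtain A S B where s: "separates V u v A S B"
    using separates_exists[of u v V] assms(1,2) by auto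
  then have c: "{c1, c2} \<subseteq> S" using separates_common_nbr assms by auto
  have "x \<in> S \<or> y \<in> S" using separates_path[OF s assms(7-9)] assms(2,10) by auto
  then obtain z where z: "z \<in> S" "z \<in> {x, y}" by blast
  then have "card {c1, c2, z} \<le> card S" using c by (intro card_mono) auto
  moreover have "card {c1, c2, z} = 3" using z(2) assms(10) by auto
  ultimately show False using separates_partition(7)[OF s] by simp
qed

lemma nbrs_subset: "nbrs W v \<subseteq> W - {v}"
  using adj_neq[of v v] by (auto simp: in_nbrs)

lemma deg_le: "nbrs W v \<subseteq> X \<Longrightarrow> deg W v \<le> card X"
  by (simp add: deg_def card_mono)

lemma nbrs_eqI: "nbrs W v \<subseteq> X \<Longrightarrow> card X \<le> deg W v \<Longrightarrow> nbrs W v = X"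
  unfolding deg_def by (rule card_seteq) auto

text \<open>By the degree condition, at most one element of \<open>X\<close> is missing from the
  neighbourhood of \<open>v\<close>.\<close>

lemma adj_or_adj:
  assumes "nbrs W v \<subseteq> X" "card X \<le> deg W v + 1" "y \<in> X" "z \<in> X" "y \<noteq> z"
  shows "adj v y \<or> adj v z"
proof (rule ccontr)
  assume "\<not> ?thesis"
  then have "nbrs W v \<subseteq> X - {y, z}" using assms by (auto simp: in_nbrs)
  from deg_le[OF this] have "deg W v \<le> card X - 2" using assms by (simp add: card_Diff_subset)
  moreover have "card {y, z} \<le> card X" using assms by (intro card_mono) auto
  ultimately show False using assms by simp
qed

lemma deg_remove:
  assumes "x \<in> W"
  shows "deg W y = deg (W - {x}) y + (if adj x y then 1 else 0)"
proof (cases "adj x y")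
  case True
  then have "nbrs W y = insert x (nbrs (W - {x}) y)"
    using assms by (auto simp: in_nbrs adj_commute)
  then show ?thesis using True by (simp add: deg_def in_nbrs)
next
  case False
  then have "nbrs W y = nbrs (W - {x}) y" by (auto simp: in_nbrs adj_commute)
  then show ?thesis using False by (simp add: deg_def)
qed

text \<open>If \<open>x\<close> saw two vertices \<open>p\<close>, \<open>q\<close> of the K_4, then
  the edge \<open>pq\<close> would have three common neighbours: \<open>x\<close> and the other two
  vertices of the clique.\<close>

lemma clique4_outside:
  assumes "Q \<subseteq> V" "card Q = 4" "clique Q" "x \<in> V" "x \<notin> Q"
  shows "deg Q x \<le> 1"
proof (rule ccontr)
  assume "\<not> ?thesis"
  then obtain T where "T \<subseteq> nbrs Q x" "card T = 2"
    unfolding deg_def by (metis not_less_eq_eq numeral_2_eq_2 One_nat_def obtain_subset_with_card_n)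
  then obtain p q where pq: "p \<in> nbrs Q x" "q \<in> nbrs Q x" "p \<noteq> q" unfolding card_2_iff by blast
  then have "card (Q - {p, q}) = 2" using assms by (auto simp: card_Diff_subset in_nbrs)
  then obtain r s where rs: "Q - {p, q} = {r, s}" "r \<noteq> s" unfolding card_2_iff by blast
  show False
    by (rule three_common_nbrs[of p q r s x]) (use assms pq rs in \<open>auto simp: clique_def in_nbrs adj_commute\<close>)
qed

text \<open>Minimum degree 3 on five vertices means that every vertex misses at most one other. If
  \<open>x\<close> saw two of them, \<open>p\<close> and \<open>q\<close>, this near-completeness
  would produce three disjoint paths between the ends of some edge.\<close>

lemma dense5_outside:
  assumes W: "W \<subseteq> V" "card W = 5" and deg3: "\<And>v. v \<in> W \<Longrightarrow> deg W v \<ge> 3"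
    and x: "x \<in> V" "x \<notin> W"
  shows "deg W x \<le> 1"
proof (rule ccontr)
  assume "\<not> ?thesis"
  then obtain T where "T \<subseteq> nbrs W x" "card T = 2"
    unfolding deg_def by (metis not_less_eq_eq numeral_2_eq_2 One_nat_def obtain_subset_with_card_n)
  then obtain p q where pq: "p \<in> nbrs W x" "q \<in> nbrs W x" "p \<noteq> q" unfolding card_2_iff by blast
  then have "card (W - {p, q}) = 3" using assms by (auto simp: card_Diff_subset in_nbrs)
  then obtain r s t where rst: "W - {p, q} = {r, s, t}" "distinct [r, s, t]"
    by (auto simp: card_3_iff)
  have Weq: "W = {p, q, r, s, t}" using rst pq by (auto simp: in_nbrs)
  have dist: "distinct [x, p, q, r, s, t]" using rst pq x by (auto simp: in_nbrs)
  have xpq: "adj x p" "adj x q" "adj p x" "adj q x" using pq by (auto simp: in_nbrs adj_commute)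
  have miss: "adj v y \<or> adj v z" if "v \<in> W" "y \<in> W" "z \<in> W" "y \<noteq> z" "v \<noteq> y" "v \<noteq> z" for v y z
    by (rule adj_or_adj[OF nbrs_subset]) (use deg3[of v] that W in auto)
  have rst_W: "{r, s, t} \<subseteq> W" using Weq by auto
  show False
  proof (cases "adj p q")
    case True
    have two: "\<not> (adj p y \<and> adj q y \<and> adj p z \<and> adj q z)" if "y \<in> {r, s, t}" "z \<in> {r, s, t}" "y \<noteq> z" for y z
      using three_common_nbrs[of p q x y z] True that dist xpq W x Weq by auto
    \<comment> \<open>Here \<open>x\<close> and \<open>y\<close> are common neighbours of
      \<open>p\<close> and \<open>q\<close>. Since \<open>w\<close> already misses \<open>p\<close>,
      it sees \<open>z\<close>, so that \<open>p\<close>, \<open>z\<close>, \<open>w\<close>,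
      \<open>q\<close> is the third path.\<close>
    have split: "\<not> (adj p y \<and> adj q y \<and> adj p z \<and> adj q w)"
      if "y \<in> {r, s, t}" "z \<in> {r, s, t}" "w \<in> {r, s, t}" "distinct [y, z, w]" for y z w
    proof
      assume *: "adj p y \<and> adj q y \<and> adj p z \<and> adj q w"
      then have "\<not> adj p w" using two[of y w] that by auto
      then have "adj w z" using miss[of w p z] that dist Weq adj_commute[of w p] by auto
      then show False using two_common_nbrs_and_path[of p q x y z w] True * that dist xpq W x Weq
        by (auto simp: adj_commute[of z w] adj_commute[of w q])
    qed
    have "\<not> (adj p r \<and> adj q r \<and> adj p s \<and> adj q t)" "\<not> (adj p r \<and> adj q r \<and> adj p t \<and> adj q s)"
      "\<not> (adj p s \<and> adj q s \<and> adj p r \<and> adj q t)" "\<not> (adj p s \<and> adj q s \<and> adj p t \<and> adj q r)"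
      "\<not> (adj p t \<and> adj q t \<and> adj p r \<and> adj q s)" "\<not> (adj p t \<and> adj q t \<and> adj p s \<and> adj q r)"
      by (rule split; use dist in auto)+
    moreover have "\<not> (adj p r \<and> adj q r \<and> adj p s \<and> adj q s)" "\<not> (adj p s \<and> adj q s \<and> adj p t \<and> adj q t)"
      "\<not> (adj p r \<and> adj q r \<and> adj p t \<and> adj q t)"
      by (rule two; use dist in auto)+
    moreover have "adj p r \<or> adj p s" "adj p s \<or> adj p t" "adj p r \<or> adj p t"
      "adj q r \<or> adj q s" "adj q s \<or> adj q t" "adj q r \<or> adj q t"
      by (rule miss; use dist Weq in auto)+
    ultimately show False
      by (cases "adj p r"; cases "adj p s"; cases "adj q r"; cases "adj q s"; simp)
  next
    case False
    then have all: "adj p y" "adj q y" if "y \<in> {r, s, t}" for y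
      using miss[of p q y] miss[of q p y] that dist Weq by (auto simp: adj_commute)
    \<comment> \<open>The edge is now \<open>py\<close>: its ends have the common neighbours
      \<open>z\<close> and \<open>w\<close>, and \<open>p\<close>, \<open>x\<close>,
      \<open>q\<close>, \<open>y\<close> is the third path.\<close>
    have centre: "\<not> (adj y z \<and> adj y w)"
      if "y \<in> {r, s, t}" "z \<in> {r, s, t}" "w \<in> {r, s, t}" "distinct [y, z, w]" for y z w
      using two_common_nbrs_and_path[of p y z w x q] all that dist xpq W x Weq by auto
    have "\<not> (adj r s \<and> adj r t)" "\<not> (adj s r \<and> adj s t)" "\<not> (adj t r \<and> adj t s)"
      by (rule centre; use dist in auto)+
    moreover have "adj r s \<or> adj r t" "adj s r \<or> adj s t" "adj t r \<or> adj t s"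
      by (rule miss; use dist Weq in auto)+
    ultimately show False using adj_commute by blast
  qed
qed

section \<open>Sizes of the two sides of a separation\<close>

lemma separates_nbrs:
  assumes "separates W u v A S B"
  shows "c \<in> A \<Longrightarrow> c \<noteq> u \<Longrightarrow> nbrs W c \<subseteq> A \<union> S - {c}"
    and "nbrs W u \<subseteq> insert v (A \<union> S - {u})"
proof -
  note part = separates_partition[OF assms]
  have AS: "y \<in> A \<union> S" if "y \<in> W" "y \<notin> B" for y using that part(1) by blast
  show "nbrs W c \<subseteq> A \<union> S - {c}" if c: "c \<in> A" "c \<noteq> u"
  proof
    fix y assume y: "y \<in> nbrs W c"
    then have "y \<notin> B" using separates_cross(1)[OF assms c(1)] c(2) in_nbrs by blast
    then show "y \<in> A \<union> S - {c}" using y AS nbrs_subset by blast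
  qed
  show "nbrs W u \<subseteq> insert v (A \<union> S - {u})"
  proof
    fix y assume y: "y \<in> nbrs W u"
    then have "y = v \<or> y \<notin> B" using separates_cross(2)[OF assms part(5)] in_nbrs by blast
    then show "y \<in> insert v (A \<union> S - {u})" using y AS nbrs_subset by blast
  qed
qed

lemma separates_card:
  assumes "separates W u v A S B"
  shows "card (A \<union> S) + card (B \<union> S) = card W + card S" "card (A \<union> S) = card A + card S" "card S \<le> 2"
proof -
  note part = separates_partition[OF assms]
  have "card W = card (A \<union> S) + card B" unfolding part(1)
    by (rule card_Un_disjoint) (use part in auto)
  moreover have AS: "card (A \<union> S) = card A + card S"
    by (rule card_Un_disjoint) (use part in auto)
  moreover have "card (B \<union> S) = card B + card S"
    by (rule card_Un_disjoint) (use part in auto)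
  ultimately show "card (A \<union> S) + card (B \<union> S) = card W + card S" "card (A \<union> S) = card A + card S"
    by auto
  show "card S \<le> 2" by (rule part(7))
qed

text \<open>Apart from \<open>v\<close>, all neighbours of \<open>u\<close> lie in its own side, and
  \<open>u\<close> itself belongs to that side too.\<close>

lemma separates_side_ge4:
  assumes "separates W u v A S B" "deg W u \<ge> 4"
  shows "card (A \<union> S) \<ge> 4"
proof -
  have "deg W u \<le> card (insert v (A \<union> S - {u}))"
    using separates_nbrs(2)[OF assms(1)] by (rule deg_le)
  also have "\<dots> \<le> Suc (card (A \<union> S - {u}))" by (simp add: card_insert_if)
  also have "\<dots> \<le> card (A \<union> S)"
    using separates_partition(5)[OF assms(1)] card_Suc_Diff1[of "A \<union> S" u] by simp
  finally show ?thesis using assms(2) by simp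
qed

text \<open>A vertex of \<open>A\<close> other than \<open>u\<close> has all its neighbours in
  \<open>A \<union> S\<close>, so with at most 5 vertices there it must see all others and there are
  exactly 5. Since \<open>A\<close> then has at least three elements, two such vertices
  \<open>c\<close>, \<open>d\<close> exist, and they are adjacent with the remaining three vertices
  as common neighbours.\<close>

lemma separates_side_ge6:
  assumes sep: "separates W u v A S B" and "W \<subseteq> V" and deg4: "\<And>x. x \<in> W \<Longrightarrow> deg W x \<ge> 4"
  shows "card (A \<union> S) \<ge> 6"
proof (rule ccontr)
  assume "\<not> ?thesis"
  then have le5: "card (A \<union> S) \<le> 5" by simp
  have u: "u \<in> A" and AS: "A \<union> S \<subseteq> W" using sep by (auto simp: separates_def)
  have "card (A \<union> S) \<ge> 4" using separates_side_ge4[OF sep] deg4 u AS by blast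
  then have A2: "card A \<ge> card (A \<union> S) - 2" "card A \<ge> 2"
    using separates_card(2,3)[OF sep] by linarith+
  have full: "nbrs W c = A \<union> S - {c}" "card (A \<union> S) = 5" if "c \<in> A" "c \<noteq> u" for c
  proof -
    have "c \<in> W" "c \<in> A \<union> S" using that AS by auto
    then have "4 \<le> card (A \<union> S - {c})"
      using deg_le[OF separates_nbrs(1)[OF sep that]] deg4[of c] by simp
    then show "card (A \<union> S) = 5" using le5 \<open>c \<in> A \<union> S\<close> by (simp add: card_Diff_singleton)
    then show "nbrs W c = A \<union> S - {c}"
      using separates_nbrs(1)[OF sep that] deg4[of c] \<open>c \<in> W\<close> \<open>c \<in> A \<union> S\<close>
      by (intro nbrs_eqI) (auto simp: card_Diff_singleton)
  qed
  have "card (A - {u}) \<ge> 1" using A2 u by (simp add: card_Diff_singleton)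
  then obtain c where c: "c \<in> A" "c \<noteq> u" by (metis DiffE One_nat_def card.empty equals0I insertI1 not_one_le_zero)
  have "card (A - {u, c}) \<ge> 1" using A2 u c full(2)[OF c] by (simp add: card_Diff_subset)
  then obtain d where d: "d \<in> A" "d \<noteq> u" "d \<noteq> c" by (metis DiffE One_nat_def card.empty equals0I insertCI not_one_le_zero)
  have "card (A \<union> S - {c, d}) = 3" using c d full(2)[OF c] by (simp add: card_Diff_subset)
  then obtain r s t where rst: "A \<union> S - {c, d} = {r, s, t}" "distinct [r, s, t]"
    by (auto simp: card_3_iff)
  have nc: "nbrs W c = {d, r, s, t}" and nd: "nbrs W d = {c, r, s, t}"
    using full(1)[OF c] full(1)[of d] c d rst by auto
  have "adj c d \<and> adj c r \<and> adj c s \<and> adj c t" "adj d r \<and> adj d s \<and> adj d t"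
    using nc nd in_nbrs by blast+
  then show False
    using three_common_nbrs[of c d r s t] rst AS c d \<open>W \<subseteq> V\<close> by auto
qed

text \<open>Otherwise an edge could be separated with at least 6 vertices on each side, whereas the
  sizes of the sides add up to at most 9 + 2 = 11.\<close>

lemma low_degree_exists:
  assumes "W \<subseteq> V" "W \<noteq> {}" "card W \<le> 9"
  shows "\<exists>x\<in>W. deg W x \<le> 3"
proof (rule ccontr)
  assume *: "\<not> ?thesis"
  have deg4: "deg W x \<ge> 4" if "x \<in> W" for x
  proof -
    have "\<not> deg W x \<le> 3" using * that by blast
    then show ?thesis by linarith
  qed
  obtain u where u: "u \<in> W" using assms by blast
  then have "nbrs W u \<noteq> {}" using deg4[of u] by (auto simp: deg_def)
  then obtain v where v: "v \<in> W" "adj u v" by (auto simp: in_nbrs)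
  obtain A S B where sep: "separates W u v A S B" using separates_exists v u assms by blast
  have "card (A \<union> S) \<ge> 6" "card (B \<union> S) \<ge> 6"
    using separates_side_ge6[OF sep assms(1)] separates_side_ge6[OF separates_commute[OF sep] assms(1)] deg4
    by blast+
  then show False using separates_card[OF sep] assms(3) by linarith
qed

section \<open>Nullity on at most eight vertices\<close>

lemma nullity_le3:
  assumes "W \<subseteq> V" "card W \<le> 3"
  shows "nullity W \<le> 0"
  using assms
proof (induction "card W" arbitrary: W)
  case 0
  then have "edges_in W = {}" using card_edge by (fastforce simp: edges_in_def)
  then show ?case by (simp add: nullity_def)
next
  case (Suc n)
  then obtain v where v: "v \<in> W" by fastforce
  then have "nullity (W - {v}) \<le> 0" using Suc by (intro Suc(1)) auto
  moreover have "deg W v \<le> 2" using deg_le[OF nbrs_subset, of W v] v Suc by auto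
  ultimately show ?case using nullity_remove(2)[OF v Suc(3)] by linarith
qed

lemma nullity_remove3:
  assumes "W \<subseteq> V" "v \<in> W" "deg W v \<le> 3"
  shows "nullity W \<le> nullity (W - {v}) + 1"
  using nullity_remove[OF assms(2,1)] assms(3) by linarith

text \<open>Any three vertices have nullity 0, so in a dependent graph no vertex can have degree at
  most 2, and all six edges are present.\<close>

lemma nullity_4:
  assumes "W \<subseteq> V" "card W = 4"
  shows "nullity W \<le> 1" "nullity W \<ge> 1 \<Longrightarrow> clique W"
proof -
  have deg3: "deg W v \<le> 3" and rem: "nullity (W - {v}) \<le> 0" if "v \<in> W" for v
    using deg_le[OF nbrs_subset, of W v] that assms nullity_le3[of "W - {v}"] by auto
  obtain v where "v \<in> W" using assms by fastforce
  then show "nullity W \<le> 1" using nullity_remove3[OF assms(1), of v] deg3[of v] rem[of v] by linarith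
  assume *: "nullity W \<ge> 1"
  have "nbrs W v = W - {v}" if "v \<in> W" for v
  proof (rule nbrs_eqI[OF nbrs_subset])
    have "\<not> deg W v \<le> 2" using nullity_remove(2)[OF that assms(1)] * rem[OF that] by linarith
    then show "card (W - {v}) \<le> deg W v" using assms that by simp
  qed
  then show "clique W" unfolding clique_def using in_nbrs by blast
qed

text \<open>Nullity 2 would leave a K_4 after deleting \<open>x\<close>. But \<open>x\<close> has at
  most one neighbour in a K_4, so deleting it costs nothing, and the K_4 would have nullity
  2.\<close>

lemma nullity_5:
  assumes "W \<subseteq> V" "card W = 5"
  shows "nullity W \<le> 1"
proof (rule ccontr)
  assume *: "\<not> ?thesis"
  obtain x where x: "x \<in> W" "deg W x \<le> 3" using low_degree_exists[of W] assms by fastforce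
  let ?Q = "W - {x}"
  have Q: "?Q \<subseteq> V" "card ?Q = 4" using assms x by auto
  then have "clique ?Q" using nullity_4(2)[OF Q] nullity_remove3[OF assms(1) x] * by linarith
  then have "deg ?Q x \<le> 1" using clique4_outside[OF Q] x assms by blast
  then have "deg W x \<le> 2" using deg_remove[OF x(1), of x] adj_neq[of x x] by auto
  then show False using nullity_remove(2)[OF x(1) assms(1)] nullity_4(1)[OF Q] * by linarith
qed

text \<open>Deleting \<open>x\<close> lowers the degree of \<open>y\<close> to 2, so the second
  deletion is free.\<close>

lemma nullity_remove_adjacent:
  assumes "W \<subseteq> V" "x \<in> W" "y \<in> W" "adj x y" "deg W x = 3" "deg W y = 3"
  shows "nullity W \<le> nullity (W - {x, y}) + 1"
    and "deg (W - {x, y}) x = 2" "deg (W - {x, y}) y = 2"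
proof -
  have xy: "x \<noteq> y" "adj y x" "\<not> adj x x" "\<not> adj y y" using adj_neq assms(4) by (auto simp: adj_commute)
  have eq: "W - {x} - {y} = W - {x, y}" by auto
  have "deg (W - {x}) y = 2" using deg_remove[OF assms(2), of y] assms by simp
  moreover have "y \<in> W - {x}" "W - {x} \<subseteq> V" using xy assms by auto
  ultimately have "nullity (W - {x}) \<le> nullity (W - {x, y})"
    using nullity_remove(2)[of y "W - {x}"] eq by simp
  then show "nullity W \<le> nullity (W - {x, y}) + 1"
    using nullity_remove3[of W x] assms by linarith
  show "deg (W - {x, y}) x = 2"
    using deg_remove[OF assms(2), of x] deg_remove[of y "W - {x}" x] xy assms eq by simp
  show "deg (W - {x, y}) y = 2"
    using deg_remove[OF assms(2), of y] deg_remove[of y "W - {x}" y] xy assms eq by simp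
qed

text \<open>With both degree classes independent, the graph is bipartite between \<open>F\<close>
  (degree at least 4) and \<open>T\<close> (degree 3). A vertex of degree 3 exists and puts three
  vertices into \<open>F\<close>; any of those puts four into \<open>T\<close>. Six vertices are too
  few for this, and seven leave only K_{3,4}.\<close>

lemma degree_classes:
  assumes "W \<subseteq> V" "W \<noteq> {}" "card W \<le> 9"
    and deg3: "\<forall>v\<in>W. deg W v \<ge> 3"
    and indep3: "\<forall>x\<in>W. \<forall>y\<in>W. adj x y \<longrightarrow> deg W x = 3 \<longrightarrow> deg W y \<noteq> 3"
    and indep4: "\<forall>x\<in>W. \<forall>y\<in>W. adj x y \<longrightarrow> deg W x \<ge> 4 \<longrightarrow> deg W y < 4"
  shows "\<exists>F T. W = F \<union> T \<and> F \<inter> T = {} \<and> card F \<ge> 3 \<and> card T \<ge> 4 \<and>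
    (\<forall>x\<in>T. deg W x = 3 \<and> nbrs W x \<subseteq> F) \<and> (\<forall>x\<in>F. nbrs W x \<subseteq> T)"
proof -
  define F T where "F = {x \<in> W. deg W x \<ge> 4}" and "T = {x \<in> W. deg W x = 3}"
  have "deg W x = 3 \<or> deg W x \<ge> 4" if "x \<in> W" for x
  proof -
    have "deg W x \<ge> 3" using deg3 that by blast
    then show ?thesis by linarith
  qed
  then have W: "W = F \<union> T" "F \<inter> T = {}" by (auto simp: F_def T_def)
  have T: "deg W x = 3 \<and> nbrs W x \<subseteq> F" if "x \<in> T" for x
  proof -
    have x: "x \<in> W" "deg W x = 3" using that by (auto simp: T_def)
    have "y \<in> F" if "y \<in> nbrs W x" for y
    proof -
      have "y \<in> W" "adj x y" using that in_nbrs by blast+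
      then have "deg W y \<ge> 3" "deg W y \<noteq> 3" using indep3 x deg3 by blast+
      then show ?thesis using \<open>y \<in> W\<close> by (simp add: F_def)
    qed
    then show ?thesis using x by blast
  qed
  have F: "nbrs W x \<subseteq> T" if "x \<in> F" for x
  proof
    fix y assume "y \<in> nbrs W x"
    then have "y \<in> W" "adj x y" using in_nbrs by blast+
    moreover have "x \<in> W" "deg W x \<ge> 4" using that by (auto simp: F_def)
    ultimately have "deg W y \<ge> 3" "deg W y < 4" using indep4 deg3 by blast+
    then show "y \<in> T" using \<open>y \<in> W\<close> by (simp add: T_def)
  qed
  obtain x where "x \<in> W" "deg W x \<le> 3" using low_degree_exists[OF assms(1-3)] by blast
  moreover from this have "deg W x \<ge> 3" using deg3 by blast
  ultimately have x: "x \<in> T" by (simp add: T_def)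
  have F3: "card F \<ge> 3" using deg_le[of W x F] T[OF x] by simp
  then obtain y where y: "y \<in> F" by fastforce
  then have T4: "card T \<ge> 4" using deg_le[OF F[OF y]] by (simp add: F_def)
  show ?thesis
    by (intro exI[of _ F] exI[of _ T] conjI ballI W F3 T4 F T[THEN conjunct1] T[THEN conjunct2])
qed

lemma min_degree_of_nullity:
  assumes "W \<subseteq> V" "v \<in> W" "nullity (W - {v}) < nullity W"
  shows "deg W v \<ge> 3"
proof (rule ccontr)
  assume "\<not> ?thesis"
  then show False using nullity_remove(2)[OF assms(2,1)] assms(3) by linarith
qed

lemma nullity_6:
  assumes W: "W \<subseteq> V" "card W = 6"
  shows "nullity W \<le> 1"
proof (rule ccontr)
  assume *: "\<not> ?thesis"
  have deg3: "deg W v \<ge> 3" if "v \<in> W" for v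
  proof (rule min_degree_of_nullity[OF W(1) that])
    have "nullity (W - {v}) \<le> 1" using W that by (intro nullity_5) auto
    then show "nullity (W - {v}) < nullity W" using * by linarith
  qed
  have indep3: "deg W y \<noteq> 3" if xy: "x \<in> W" "y \<in> W" "adj x y" "deg W x = 3" for x y
  proof
    assume y3: "deg W y = 3"
    note r = nullity_remove_adjacent[OF W(1) xy y3]
    have "x \<noteq> y" using adj_neq xy(3) by blast
    then have Q: "W - {x, y} \<subseteq> V" "card (W - {x, y}) = 4"
      using W xy(1,2) by (auto simp: card_Diff_subset)
    then have "clique (W - {x, y})" using nullity_4(2)[OF Q] r(1) * by linarith
    then have "deg (W - {x, y}) x \<le> 1" using clique4_outside[OF Q, of x] xy(1) W(1) by blast
    then show False using r(2) by simp
  qed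
  have indep4: "deg W v < 4" if uv: "u \<in> W" "v \<in> W" "adj u v" "deg W u \<ge> 4" for u v
  proof (rule ccontr)
    assume "\<not> deg W v < 4"
    then have v4: "deg W v \<ge> 4" by simp
    obtain A S B where sep: "separates W u v A S B" using separates_exists uv W by blast
    note sep' = separates_commute[OF sep] and part = separates_partition[OF sep]
    \<comment> \<open>Both sides have at least 4 vertices and the sizes add up to at most 6 + 2, so
      equality holds throughout. The degree bounds then determine the neighbourhoods of
      \<open>u\<close>, \<open>v\<close>, \<open>c\<close> and \<open>d\<close> completely.\<close>
    have card: "card (A \<union> S) = 4" "card S = 2" "card A = 2" "card (B \<union> S) = 4" "card B = 2"
      using separates_side_ge4[OF sep uv(4)] separates_side_ge4[OF sep' v4]
        separates_card[OF sep] separates_card[OF sep'] W(2) by linarith+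
    obtain a b where ab: "S = {a, b}" "a \<noteq> b" using card(2) unfolding card_2_iff by blast
    obtain c where c: "A = {u, c}" "u \<noteq> c" using card(3) part(5) unfolding card_2_iff by blast
    obtain d where d: "B = {v, d}" "v \<noteq> d" using card(5) part(6) unfolding card_2_iff by blast
    have dist: "distinct [u, v, a, b, c, d]" using ab c d part(2-4) by auto
    have inW: "{u, v, a, b, c, d} \<subseteq> W" unfolding part(1) ab c d by blast
    have nd: "nbrs W d = {v, a, b}"
    proof (rule nbrs_eqI)
      show "nbrs W d \<subseteq> {v, a, b}" using separates_nbrs(1)[OF sep', of d] d ab by blast
      show "card {v, a, b} \<le> deg W d" using deg3[of d] inW dist by simp
    qed
    have nc: "nbrs W c = {u, a, b}"
    proof (rule nbrs_eqI)
      show "nbrs W c \<subseteq> {u, a, b}" using separates_nbrs(1)[OF sep, of c] c ab by blast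
      show "card {u, a, b} \<le> deg W c" using deg3[of c] inW dist by simp
    qed
    have nu: "nbrs W u = {v, c, a, b}"
    proof (rule nbrs_eqI)
      show "nbrs W u \<subseteq> {v, c, a, b}" using separates_nbrs(2)[OF sep] c ab by blast
      show "card {v, c, a, b} \<le> deg W u" using uv(4) dist by auto
    qed
    have nv: "nbrs W v = {u, d, a, b}"
    proof (rule nbrs_eqI)
      show "nbrs W v \<subseteq> {u, d, a, b}" using separates_nbrs(2)[OF sep'] d ab by blast
      show "card {u, d, a, b} \<le> deg W v" using v4 dist by auto
    qed
    \<comment> \<open>The contradiction is at the edge \<open>ua\<close>: common neighbours
      \<open>c\<close> and \<open>v\<close>, and the path \<open>u\<close>, \<open>b\<close>,
      \<open>d\<close>, \<open>a\<close>.\<close>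
    have "adj u a" "adj u c" "adj u v" "adj u b" using nu in_nbrs by blast+
    moreover have "adj a c" using nc in_nbrs adj_commute by blast
    moreover have "adj a v" using nv in_nbrs adj_commute by blast
    moreover have "adj b d" "adj d a" using nd in_nbrs adj_commute by blast+
    moreover have "{u, a, c, v, b, d} \<subseteq> V" using inW W(1) by blast
    moreover have "distinct [u, a, c, v, b, d]" using dist by auto
    ultimately show False using two_common_nbrs_and_path by blast
  qed
  from W have "W \<noteq> {}" "card W \<le> 9" by auto
  moreover have "\<forall>v\<in>W. deg W v \<ge> 3" "\<forall>x\<in>W. \<forall>y\<in>W. adj x y \<longrightarrow> deg W x = 3 \<longrightarrow> deg W y \<noteq> 3"
      "\<forall>x\<in>W. \<forall>y\<in>W. adj x y \<longrightarrow> deg W x \<ge> 4 \<longrightarrow> deg W y < 4"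
    using deg3 indep3 indep4 by blast+
  ultimately obtain F T where "W = F \<union> T" "F \<inter> T = {}" "card F \<ge> 3" "card T \<ge> 4"
    using degree_classes[OF W(1)] by blast
  then show False using W(2) by (simp add: card_Un_disjoint)
qed

text \<open>Each of \<open>x\<close>, \<open>y\<close>, \<open>w\<close> has at most one neighbour
  in \<open>Q\<close>, so by its degree it sees the other two and exactly one vertex of
  \<open>Q\<close>. That vertex is the same for all three and completes the second K_4.\<close>

lemma clique4_union:
  assumes Weq: "W = insert x (insert y (insert w Q))" and "W \<subseteq> V"
    and deg3: "\<And>v. v \<in> W \<Longrightarrow> deg W v \<ge> 3"
    and dist: "distinct [x, y, w]" "x \<notin> Q" "y \<notin> Q" "w \<notin> Q"
    and Q: "clique Q" "card Q = 4"
  shows "\<exists>Q Q'. clique Q \<and> clique Q' \<and> card Q = 4 \<and> card Q' = 4 \<and> W = Q \<union> Q'"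
proof -
  have QV: "Q \<subseteq> V" and inW: "x \<in> W" "y \<in> W" "w \<in> W" using assms(2) unfolding Weq by blast+
  have outer: "\<exists>q\<in>Q. adj z q \<and> adj z z1 \<and> adj z z2 \<and> (\<forall>q'\<in>Q. adj z q' \<longrightarrow> q' = q)"
    if z: "W = insert z (insert z1 (insert z2 Q))" "z \<in> W" "z \<notin> Q" for z z1 z2
  proof -
    have sub: "nbrs W z \<subseteq> nbrs Q z \<union> (nbrs W z \<inter> {z1, z2})"
    proof
      fix y assume "y \<in> nbrs W z"
      then have "y \<in> W" "adj z y" "y \<noteq> z" using in_nbrs adj_neq by blast+
      then show "y \<in> nbrs Q z \<union> (nbrs W z \<inter> {z1, z2})" using z(1) in_nbrs by blast
    qed
    have le1: "card (nbrs Q z) \<le> 1"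
      using clique4_outside[OF QV Q(2,1), of z] z(2,3) \<open>W \<subseteq> V\<close> unfolding deg_def by blast
    have "3 \<le> card (nbrs W z)" using deg3[OF z(2)] by (simp add: deg_def)
    also have "\<dots> \<le> card (nbrs Q z \<union> (nbrs W z \<inter> {z1, z2}))" by (rule card_mono[OF _ sub]) simp
    also have "\<dots> \<le> card (nbrs Q z) + card (nbrs W z \<inter> {z1, z2})" by (rule card_Un_le)
    finally have le: "3 \<le> card (nbrs Q z) + card (nbrs W z \<inter> {z1, z2})" .
    have le2: "card (nbrs W z \<inter> {z1, z2}) \<le> card {z1, z2}" by (rule card_mono) auto
    have "card {z1, z2} \<le> 2" by (simp add: card_insert_if)
    then have eq: "card (nbrs Q z) = 1" "card (nbrs W z \<inter> {z1, z2}) = card {z1, z2}"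
      using le le1 le2 by linarith+
    have "nbrs W z \<inter> {z1, z2} = {z1, z2}" by (rule card_subset_eq) (use eq in auto)
    then have "adj z z1" "adj z z2" using in_nbrs by blast+
    moreover obtain q where q: "nbrs Q z = {q}" using eq(1) by (rule card_1_singletonE)
    then have "q \<in> nbrs Q z" by simp
    then have "q \<in> Q" "adj z q" unfolding in_nbrs by blast+
    moreover have "q' = q" if "q' \<in> Q" "adj z q'" for q'
    proof -
      have "q' \<in> nbrs Q z" unfolding in_nbrs using that by blast
      then show ?thesis using q by simp
    qed
    ultimately show ?thesis by blast
  qed
  obtain qx where qx: "qx \<in> Q" "adj x qx" "adj x y" "adj x w" "\<And>q'. q' \<in> Q \<Longrightarrow> adj x q' \<Longrightarrow> q' = qx"
    using outer[OF Weq inW(1) dist(2)] by blast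
  have "W = insert y (insert x (insert w Q))" using Weq by blast
  then obtain qy where qy: "qy \<in> Q" "adj y qy" "adj y w" "\<And>q'. q' \<in> Q \<Longrightarrow> adj y q' \<Longrightarrow> q' = qy"
    using outer[OF _ inW(2) dist(3), of x w] by blast
  have "W = insert w (insert x (insert y Q))" using Weq by blast
  then obtain qw where qw: "qw \<in> Q" "adj w qw" "\<And>q'. q' \<in> Q \<Longrightarrow> adj w q' \<Longrightarrow> q' = qw"
    using outer[OF _ inW(3) dist(4), of x y] by blast
  \<comment> \<open>Different attachments \<open>q\<close> and \<open>q'\<close> would give the edge
    \<open>qq'\<close> two common neighbours inside \<open>Q\<close> and the path \<open>q\<close>,
    \<open>z\<close>, \<open>z'\<close>, \<open>q'\<close> outside.\<close>
  have same: "q = q'" if z: "z \<in> {x, y, w}" "z' \<in> {x, y, w}" "adj z z'" "q \<in> Q" "q' \<in> Q" "adj z q" "adj z' q'" for z z' q q'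
  proof (rule ccontr)
    assume ne: "q \<noteq> q'"
    then have "card (Q - {q, q'}) = 2" using Q(2) z by (simp add: card_Diff_subset)
    then obtain r s where rs: "Q - {q, q'} = {r, s}" "r \<noteq> s" unfolding card_2_iff by blast
    have in_Q: "{q, q', r, s} \<subseteq> Q" "r \<notin> {q, q'}" "s \<notin> {q, q'}" using rs z by blast+
    have adj_Q: "adj a b" if "a \<in> Q" "b \<in> Q" "a \<noteq> b" for a b
      using Q(1) that unfolding clique_def by blast
    have "adj q q'" "adj q r" "adj q' r" "adj q s" "adj q' s"
      by (rule adj_Q; use in_Q ne in auto)+
    moreover have "adj q z" "adj z' q'" using z(6,7) by (simp_all add: adj_commute)
    moreover have "{q, q', r, s, z, z'} \<subseteq> V" using in_Q(1) QV z(1,2) inW \<open>W \<subseteq> V\<close> by blast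
    moreover have "distinct [q, q', r, s, z, z']"
      using in_Q ne rs(2) z(1,2) dist adj_neq[OF z(3)] by auto
    ultimately show False using two_common_nbrs_and_path[of q q' r s z z'] z(3) by simp
  qed
  have eq: "qx = qy" by (rule same[of x y]) (use qx(1-3) qy(1,2) in simp_all)
  have eq': "qx = qw" by (rule same[of x w]) (use qx(1,2,4) qw(1,2) in simp_all)
  have "clique {qx, x, y, w}" unfolding clique_def
    using qx(2-4) qy(2,3) qw(2) eq eq' by (simp add: adj_commute)
  moreover have "card {qx, x, y, w} = 4"
  proof -
    have "distinct [qx, x, y, w]" using dist qx(1) by auto
    from distinct_card[OF this] show ?thesis by simp
  qed
  moreover have "W = Q \<union> {qx, x, y, w}" using Weq qx(1) by blast
  ultimately show ?thesis using Q by blast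
qed

text \<open>A vertex of \<open>A\<close> other than \<open>u\<close> sees all of its side and has
  degree 3. Two of them would be adjacent, so there is only one, \<open>c\<close>, and the whole
  partition is known: two vertices in \<open>A\<close>, two in \<open>S\<close>, three in
  \<open>B\<close>. The outcome is that the two vertices of \<open>B\<close> other than
  \<open>v\<close> have degree 3 and are adjacent, contrary to \<open>indep3\<close>.\<close>

lemma no_side4:
  assumes W: "W \<subseteq> V" "card W = 7" and deg3: "\<And>v. v \<in> W \<Longrightarrow> deg W v \<ge> 3"
    and indep3: "\<And>x y. \<lbrakk>x \<in> W; y \<in> W; adj x y; deg W x = 3\<rbrakk> \<Longrightarrow> deg W y \<noteq> 3"
    and sep: "separates W u v A S B" and uv: "adj u v" "deg W u \<ge> 4" "deg W v \<ge> 4"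
    and card4: "card (A \<union> S) = 4"
  shows False
proof -
  note part = separates_partition[OF sep] and cards = separates_card[OF sep]
  note sep' = separates_commute[OF sep]
  have nA: "nbrs W c = A \<union> S - {c}" "deg W c = 3" if "c \<in> A" "c \<noteq> u" for c
  proof -
    have "card (A \<union> S - {c}) = 3" using card4 that(1) by simp
    moreover have "deg W c \<ge> 3" using that(1) part(1) by (intro deg3) blast
    ultimately show "nbrs W c = A \<union> S - {c}"
      using separates_nbrs(1)[OF sep that] by (intro nbrs_eqI) auto
    then show "deg W c = 3" using \<open>card (A \<union> S - {c}) = 3\<close> by (simp add: deg_def)
  qed
  have unique: "c = d" if "c \<in> A" "c \<noteq> u" "d \<in> A" "d \<noteq> u" for c d
  proof (rule ccontr)
    assume "c \<noteq> d"
    then have "adj c d" using nA(1)[OF that(1,2)] that(3) in_nbrs by blast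
    then show False using indep3[of c d] nA(2)[OF that(1,2)] nA(2)[OF that(3,4)] that(1,3) part(1) by blast
  qed
  have "card A \<ge> 2" using card4 cards by linarith
  then have "A - {u} \<noteq> {}" using part(5) by (auto simp: subset_singleton_iff dest!: card_mono[rotated])
  then obtain c where c: "c \<in> A" "c \<noteq> u" by blast
  then have Aeq: "A = {u, c}" using unique part(5) by blast
  then have "card A = 2" using c by simp
  then have "card S = 2" "card B = 3" using card4 cards W(2) separates_card(2)[OF sep'] by linarith+
  then obtain a b where ab: "S = {a, b}" "a \<noteq> b" unfolding card_2_iff by blast
  have "card (B - {v}) = 2" using \<open>card B = 3\<close> part(6) by simp
  then obtain x y where xy: "B - {v} = {x, y}" "x \<noteq> y" unfolding card_2_iff by blast
  have Beq: "B = {v, x, y}" using xy part(6) by blast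
  have dist: "distinct [u, c, a, b, v, x, y]"
    using Aeq ab(2) xy c(2) part(2-4) unfolding Aeq ab(1) Beq by auto
  have nc: "nbrs W c = {u, a, b}" using nA(1)[OF c] dist unfolding Aeq ab by auto
  have nu: "nbrs W u = {v, c, a, b}"
  proof (rule nbrs_eqI)
    show "nbrs W u \<subseteq> {v, c, a, b}" using separates_nbrs(2)[OF sep] Aeq ab by blast
    show "card {v, c, a, b} \<le> deg W u" using uv(2) dist by auto
  qed
  have base: "adj u v" "adj v u" "adj u c" "adj u a" "adj a u" "adj u b" "adj b u" "adj c a" "adj a c" "adj c b" "adj b c"
  proof -
    have u: "adj u v" "adj u c" "adj u a" "adj u b" using nu in_nbrs by blast+
    have c: "adj c a" "adj c b" using nc in_nbrs by blast+
    show "adj u v" "adj v u" "adj u c" "adj u a" "adj a u" "adj u b" "adj b u" "adj c a" "adj a c" "adj c b" "adj b c"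
      using u c by (simp_all add: adj_commute)
  qed
  have nv: "nbrs W v \<subseteq> {u, a, b, x, y}"
    using separates_nbrs(2)[OF sep'] unfolding Beq ab by blast
  have main: False if va: "adj v a" and ab': "S = {a, b}" "distinct [u, c, a, b, v, x, y]"
      and base: "adj u v" "adj v u" "adj u c" "adj u a" "adj a u" "adj u b" "adj b u" "adj c a" "adj a c" "adj c b" "adj b c" for a b
  proof -
    have Weq: "W = {u, c, a, b, v, x, y}" using part(1) unfolding Aeq ab' Beq by blast
    have card_V: "{u, c, a, b, v, x, y} \<subseteq> V" using W(1) unfolding Weq .
    have deg4: "deg W a \<ge> 4" "deg W b \<ge> 4"
      using indep3[of c a] indep3[of c b] nA(2)[OF c] base deg3[of a] deg3[of b] Weq by fastforce+
    have nx: "nbrs W x \<subseteq> {v, a, b, y}" and ny: "nbrs W y \<subseteq> {v, a, b, x}"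
      using separates_nbrs(1)[OF sep', of x] separates_nbrs(1)[OF sep', of y] ab'(2) unfolding Beq ab'(1) by auto
    \<comment> \<open>Otherwise the ends of the edge \<open>ua\<close> have the common neighbours
      \<open>c\<close>, \<open>v\<close> and \<open>b\<close>.\<close>
    have "\<not> adj a b"
      using three_common_nbrs[of u a c v b] base va ab'(2) card_V by (auto simp: adj_commute)
    then have na: "nbrs W a \<subseteq> {c, u, v, x, y}" and nb: "nbrs W b \<subseteq> {c, u, v, x, y}"
      using nbrs_subset[of W a] nbrs_subset[of W b] adj_commute[of a b] in_nbrs unfolding Weq by blast+
    have "adj a x \<or> adj a y"
      by (rule adj_or_adj[OF na]) (use deg4 ab'(2) in auto)
    moreover have "adj b x \<or> adj b y"
      by (rule adj_or_adj[OF nb]) (use deg4 ab'(2) in auto)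
    \<comment> \<open>The edge \<open>ua\<close> has the common neighbours \<open>c\<close> and
      \<open>v\<close>; a vertex \<open>z\<close> seen by both \<open>a\<close> and \<open>b\<close>
      would add the path \<open>u\<close>, \<open>b\<close>, \<open>z\<close>,
      \<open>a\<close>.\<close>
    moreover have not_both: "\<not> (adj a z \<and> adj b z)" if "z \<in> {x, y}" for z
      using two_common_nbrs_and_path[of u a c v b z] base va that ab'(2) card_V by (auto simp: adj_commute)
    moreover have three: "adj z z' \<and> deg W z = 3"
      if z: "z \<in> W" "nbrs W z \<subseteq> {v, a, b, z'}" "distinct [v, a, b, z']" "\<not> (adj a z \<and> adj b z)" for z z'
    proof -
      obtain e where e: "e \<in> {a, b}" "\<not> adj z e" using z(4) adj_commute by blast
      have sub: "nbrs W z \<subseteq> {v, a, b, z'} - {e}" using z(2) e(2) in_nbrs by blast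
      have card3: "card ({v, a, b, z'} - {e}) = 3" using e(1) z(3) by auto
      then have "nbrs W z = {v, a, b, z'} - {e}" using deg3[OF z(1)] by (intro nbrs_eqI sub) simp
      then show ?thesis using card3 e(1) z(3) in_nbrs[of z' W z] by (auto simp: deg_def)
    qed
    have "adj x y \<and> deg W x = 3" by (rule three[OF _ nx]) (use Weq ab'(2) not_both in auto)
    moreover have "adj y x \<and> deg W y = 3" by (rule three[OF _ ny]) (use Weq ab'(2) not_both in auto)
    ultimately show False using indep3[of x y] Weq by blast
  qed
  have "adj v a \<or> adj v b"
    by (rule adj_or_adj[OF nv]) (use uv(3) dist in auto)
  then show False
  proof
    assume "adj v a"
    then show False using ab(1) dist base by (rule main)
  next
    assume "adj v b"
    then show False
    proof (rule main)
      show "S = {b, a}" using ab(1) by blast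
      show "distinct [u, c, b, a, v, x, y]" using dist by auto
    qed (use base in blast)+
  qed
qed

text \<open>Deleting one vertex of the larger class leaves an independent K_{3,3} and lowers the
  nullity by at most 1.\<close>

lemma nullity_K34:
  assumes W: "F \<union> T \<subseteq> V" "F \<inter> T = {}" "card F = 3" "card T = 4"
    and T: "\<And>x. x \<in> T \<Longrightarrow> nbrs (F \<union> T) x = F" and F: "\<And>x. x \<in> F \<Longrightarrow> nbrs (F \<union> T) x \<subseteq> T"
  shows "nullity (F \<union> T) \<le> 1"
proof -
  obtain t where t: "t \<in> T" using W(4) by fastforce
  let ?T = "T - {t}"
  have eq: "F \<union> T - {t} = F \<union> ?T" using t W(2) by blast
  have "edges_in (F \<union> ?T) = {{a, b} | a b. a \<in> F \<and> b \<in> ?T}"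
  proof (intro equalityI subsetI)
    fix e assume e: "e \<in> edges_in (F \<union> ?T)"
    then obtain x y where xy: "e = {x, y}" using card_edge[of e] by (auto simp: edges_in_def card_2_iff)
    then have "adj x y" "x \<in> F \<union> ?T" "y \<in> F \<union> ?T" using e by (auto simp: edges_in_def adj_def)
    then have "x \<in> F \<and> y \<in> ?T \<or> y \<in> F \<and> x \<in> ?T"
      using T[of x] F[of x] W(2) in_nbrs[of y "F \<union> T" x] by blast
    then show "e \<in> {{a, b} | a b. a \<in> F \<and> b \<in> ?T}" using xy by blast
  next
    fix e assume "e \<in> {{a, b} | a b. a \<in> F \<and> b \<in> ?T}"
    then obtain a b where ab: "e = {a, b}" "a \<in> F" "b \<in> ?T" by blast
    then have "adj b a" using T[of b] in_nbrs by blast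
    then show "e \<in> edges_in (F \<union> ?T)" using ab adj_commute by (auto simp: edges_in_def adj_def)
  qed
  then have "nullity (F \<union> ?T) \<le> 0"
    using W t by (intro nullity_K33) auto
  moreover have "deg (F \<union> T) t \<le> 3" using T[OF t] W(3) by (simp add: deg_def)
  ultimately show ?thesis using nullity_remove3[OF W(1), of t] t eq by simp
qed

text \<open>An adjacent pair of vertices of degree 3 produces the two cliques, and no edge joins two
  vertices of degree at least 4. Failing the cliques, both degree classes are independent and only
  K_{3,4} is left, whose nullity is too small.\<close>

lemma nullity_7_clique4_union:
  assumes W: "W \<subseteq> V" "card W = 7" and null: "nullity W \<ge> 2"
  shows "\<exists>Q Q'. clique Q \<and> clique Q' \<and> card Q = 4 \<and> card Q' = 4 \<and> W = Q \<union> Q'"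
proof (rule ccontr)
  assume no: "\<not> ?thesis"
  have deg3: "deg W v \<ge> 3" if "v \<in> W" for v
  proof (rule min_degree_of_nullity[OF W(1) that])
    have "nullity (W - {v}) \<le> 1" using W that by (intro nullity_6) auto
    then show "nullity (W - {v}) < nullity W" using null by linarith
  qed
  have indep3: "deg W y \<noteq> 3" if xy: "x \<in> W" "y \<in> W" "adj x y" "deg W x = 3" for x y
  proof
    assume y3: "deg W y = 3"
    note r = nullity_remove_adjacent[OF W(1) xy y3]
    let ?U = "W - {x, y}"
    have "x \<noteq> y" using adj_neq xy(3) by blast
    then have U: "?U \<subseteq> V" "card ?U = 5"
      using W xy(1,2) by (auto simp: card_Diff_subset)
    \<comment> \<open>After the deletion \<open>x\<close> still has two neighbours in
      \<open>?U\<close>, which \<open>dense5_outside\<close> rules out if all degrees in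
      \<open>?U\<close> are at least 3. A vertex \<open>w\<close> can therefore be deleted at no
      cost, leaving a dependent graph on four vertices, that is, a K_4.\<close>
    have "\<not> (\<forall>v\<in>?U. deg ?U v \<ge> 3)"
    proof
      assume "\<forall>v\<in>?U. deg ?U v \<ge> 3"
      then have "deg ?U x \<le> 1" using dense5_outside[OF U, of x] xy(1) W(1) by blast
      then show False using r(2) by simp
    qed
    then obtain w where w: "w \<in> ?U" "deg ?U w \<le> 2" by fastforce
    then have "nullity (?U - {w}) \<ge> 1" using nullity_remove(2)[OF w(1) U(1)] r(1) null by linarith
    moreover have "?U - {w} \<subseteq> V" "card (?U - {w}) = 4" using U w(1) by auto
    ultimately have "clique (?U - {w})" by (intro nullity_4(2))
    moreover have "W = insert x (insert y (insert w (?U - {w})))" using xy(1,2) w(1) by blast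
    moreover have "distinct [x, y, w]" "x \<notin> ?U - {w}" "y \<notin> ?U - {w}" "w \<notin> ?U - {w}"
      using \<open>x \<noteq> y\<close> w(1) by auto
    ultimately show False using clique4_union[OF _ W(1) deg3] \<open>card (?U - {w}) = 4\<close> no by blast
  qed
  have indep4: "deg W v < 4" if uv: "u \<in> W" "v \<in> W" "adj u v" "deg W u \<ge> 4" for u v
  proof (rule ccontr)
    assume "\<not> deg W v < 4"
    then have v4: "deg W v \<ge> 4" by simp
    obtain A S B where sep: "separates W u v A S B" using separates_exists uv W by blast
    note sep' = separates_commute[OF sep]
    have "card (A \<union> S) = 4 \<or> card (B \<union> S) = 4"
      using separates_side_ge4[OF sep uv(4)] separates_side_ge4[OF sep' v4]
        separates_card[OF sep] W(2) by linarith
    then show False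
    proof
      assume "card (A \<union> S) = 4"
      with W deg3 indep3 sep uv(3,4) v4 show False by (rule no_side4)
    next
      assume 4: "card (B \<union> S) = 4"
      have "adj v u" using uv(3) adj_commute by blast
      from W deg3 indep3 sep' this v4 uv(4) 4 show False by (rule no_side4)
    qed
  qed
  from W have "W \<noteq> {}" "card W \<le> 9" by auto
  moreover have "\<forall>v\<in>W. deg W v \<ge> 3" "\<forall>x\<in>W. \<forall>y\<in>W. adj x y \<longrightarrow> deg W x = 3 \<longrightarrow> deg W y \<noteq> 3"
      "\<forall>x\<in>W. \<forall>y\<in>W. adj x y \<longrightarrow> deg W x \<ge> 4 \<longrightarrow> deg W y < 4"
    using deg3 indep3 indep4 by blast+
  ultimately obtain F T where FT: "W = F \<union> T" "F \<inter> T = {}" "card F \<ge> 3" "card T \<ge> 4"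
    "\<forall>x\<in>T. deg W x = 3 \<and> nbrs W x \<subseteq> F" "\<forall>x\<in>F. nbrs W x \<subseteq> T"
    using degree_classes[OF W(1)] by blast
  have "card W = card F + card T" unfolding FT(1) using FT(2) by (simp add: card_Un_disjoint)
  then have cards: "card F = 3" "card T = 4" using W(2) FT(3,4) by linarith+
  have "nbrs W x = F" if "x \<in> T" for x
    using bspec[OF FT(5) that] cards by (intro nbrs_eqI) auto
  then have "nullity (F \<union> T) \<le> 1"
    using W(1) bspec[OF FT(6)] unfolding FT(1) by (intro nullity_K34 FT(2) cards)
  then show False using null FT(1) by simp
qed

lemma nullity_7:
  assumes W: "W \<subseteq> V" "card W = 7"
  shows "nullity W \<le> 2"
proof -
  obtain x where x: "x \<in> W" "deg W x \<le> 3" using low_degree_exists[of W] assms by fastforce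
  have "nullity (W - {x}) \<le> 1" using W x(1) by (intro nullity_6) auto
  then show ?thesis using nullity_remove3[OF W(1) x] by linarith
qed

text \<open>Nullity 3 would need a vertex \<open>x\<close> of degree 3 over a union of two copies of
  K_4. But \<open>x\<close> has at most one neighbour in each copy.\<close>

lemma nullity_8:
  assumes W: "W \<subseteq> V" "card W = 8"
  shows "nullity W \<le> 2"
proof (rule ccontr)
  assume *: "\<not> ?thesis"
  obtain x where x: "x \<in> W" "deg W x \<le> 3" using low_degree_exists[of W] assms by fastforce
  let ?U = "W - {x}"
  have U: "?U \<subseteq> V" "card ?U = 7" using W x by auto
  have "nullity ?U \<ge> 2" using nullity_remove3[OF W(1) x] * by linarith
  from nullity_7_clique4_union[OF U this] obtain Q Q' where
    Q: "clique Q" "card Q = 4" "clique Q'" "card Q' = 4" "?U = Q \<union> Q'" by blast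
  have sub: "Q \<subseteq> V" "Q' \<subseteq> V" "x \<notin> Q" "x \<notin> Q'" "x \<in> V" using Q(5) U W(1) x(1) by blast+
  have "nbrs W x \<subseteq> nbrs Q x \<union> nbrs Q' x"
  proof
    fix y assume "y \<in> nbrs W x"
    then have "y \<in> W" "adj x y" "y \<noteq> x" using in_nbrs adj_neq by blast+
    then show "y \<in> nbrs Q x \<union> nbrs Q' x" using Q(5) in_nbrs by blast
  qed
  then have "deg W x \<le> card (nbrs Q x \<union> nbrs Q' x)" by (rule deg_le)
  also have "\<dots> \<le> deg Q x + deg Q' x" unfolding deg_def by (rule card_Un_le)
  also have "\<dots> \<le> 2" using clique4_outside[OF sub(1) Q(2,1) sub(5,3)] clique4_outside[OF sub(2) Q(4,3) sub(5,4)] by simp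
  finally have "nullity W \<le> nullity ?U" using nullity_remove(2)[OF x(1) W(1)] by simp
  then show False using nullity_7[OF U] * by linarith
qed

lemma nullity_bound:
  assumes "W \<subseteq> V" "card W \<ge> 6"
  shows "nullity W \<le> int (card W) - 5 \<and> (card W \<ge> 8 \<longrightarrow> nullity W \<le> int (card W) - 6)"
  using assms
proof (induction "card W" arbitrary: W rule: less_induct)
  case less
  note W = less.prems
  consider "card W = 6" | "card W = 7" | "card W = 8" | "card W \<ge> 9" using W(2) by linarith
  then show ?case
  proof cases
    case 4
    have "nullity W \<le> int (card W) - 6"
    proof (cases "\<exists>x\<in>W. deg W x \<le> 3")
      case True
      then obtain x where x: "x \<in> W" "deg W x \<le> 3" by blast
      then have c: "card (W - {x}) = card W - 1" by simp
      \<comment> \<open>At least 8 vertices remain, so the strong bound is available, and the lost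
        vertex pays for the drop of 1.\<close>
      then have "nullity (W - {x}) \<le> int (card (W - {x})) - 6"
        using less.hyps[of "W - {x}"] W 4 by fastforce
      then show ?thesis using nullity_remove3[OF W(1) x] c 4 by linarith
    next
      case False
      have deg4: "deg W x \<ge> 4" if "x \<in> W" for x
      proof -
        have "\<not> deg W x \<le> 3" using False that by blast
        then show ?thesis by linarith
      qed
      obtain u where u: "u \<in> W" using 4 by fastforce
      then have "nbrs W u \<noteq> {}" using deg4[of u] by (auto simp: deg_def)
      then obtain v where v: "v \<in> W" "adj u v" using in_nbrs by blast
      obtain A S B where sep: "separates W u v A S B" using separates_exists v u W(1) by blast
      note part = separates_partition[OF sep] and cards = separates_card[OF sep]
      have ge6: "card (A \<union> S) \<ge> 6" "card (B \<union> S) \<ge> 6"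
        using separates_side_ge6[OF sep W(1)] separates_side_ge6[OF separates_commute[OF sep] W(1)] deg4
        by blast+
      \<comment> \<open>The sizes add up to at most \<open>card W + 2\<close> and each is at least
        6, so each is at most \<open>card W - 4\<close>.\<close>
      have lt: "card (A \<union> S) < card W" "card (B \<union> S) < card W" using ge6 cards by linarith+
      have sub: "A \<union> S \<subseteq> V" "B \<union> S \<subseteq> V" using part(1) W(1) by blast+
      \<comment> \<open>The cut may have fewer than two vertices; it is padded to two, as gluing
        refers to two distinct points.\<close>
      obtain T where T: "S \<subseteq> T" "T \<subseteq> W" "card T = 2"
        using exists_subset_between[of S 2 W] part(1,7) 4 by auto
      then obtain a b where ab: "T = {a, b}" "a \<noteq> b" unfolding card_2_iff by blast
      have "nullity W \<le> nullity (A \<union> S) + nullity (B \<union> S) + 2"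
      proof (rule nullity_gluing[of _ _ a b _ "{u, v}"])
        show "(A \<union> S) \<inter> (B \<union> S) \<subseteq> {a, b}" using part(2-4) T(1) ab(1) by blast
        show "a \<noteq> b" "a \<in> V" "b \<in> V" using ab T(2) W(1) by blast+
        show "A \<union> S \<union> (B \<union> S) = W" using part(1) by blast
        show "edges_in W \<subseteq> insert {u, v} (edges_in (A \<union> S) \<union> edges_in (B \<union> S))"
        proof
          fix e assume e: "e \<in> edges_in W"
          then obtain x y where xy: "e = {x, y}" using card_edge[of e] by (auto simp: edges_in_def card_2_iff)
          then have "adj x y" "adj y x" "x \<in> W" "y \<in> W" "e \<in> E"
            using e adj_commute[of x y] by (auto simp: edges_in_def adj_def)
          then have "e = {u, v} \<or> {x, y} \<subseteq> A \<union> S \<or> {x, y} \<subseteq> B \<union> S"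
            using separates_cross[OF sep, of x y] separates_cross[OF sep, of y x] part(1) xy by blast
          then show "e \<in> insert {u, v} (edges_in (A \<union> S) \<union> edges_in (B \<union> S))"
            using \<open>e \<in> E\<close> xy by (auto simp: edges_in_def)
        qed
      qed
      moreover have "nullity (A \<union> S) \<le> int (card (A \<union> S)) - 5"
        using less.hyps[OF lt(1) sub(1) ge6(1)] by blast
      moreover have "nullity (B \<union> S) \<le> int (card (B \<union> S)) - 5"
        using less.hyps[OF lt(2) sub(2) ge6(2)] by blast
      ultimately show ?thesis using cards by linarith
    qed
    then show ?thesis by linarith
  qed (use nullity_6[OF W(1)] nullity_7[OF W(1)] nullity_8[OF W(1)] in auto)
qed

end

section \<open>Generic frameworks of minimally 3-connected graphs\<close>

lemma generic_nonzero:
  fixes p q :: "'v::finite \<Rightarrow> real^2"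
  assumes "generic V p" "rat_polynomial (V \<times> UNIV) (\<lambda>x. F (\<lambda>v. \<chi> i. x (v, i)))" "F q \<noteq> 0"
  shows "F p \<noteq> 0"
  using alg_independent_nonzero[OF assms(1)[unfolded generic_def] assms(2), of "\<lambda>(v, i). q v $ i"] assms(3)
  by simp

lemma rat_polynomial_area:
  fixes V :: "'v::finite set"
  assumes "a \<in> V" "b \<in> V" "c \<in> V"
  shows "rat_polynomial (V \<times> UNIV) (\<lambda>x. area (\<chi> i. x (a, i)) (\<chi> i. x (b, i)) (\<chi> i. x (c, i)))"
  using assms unfolding area_def cross2_def by (auto intro!: rat_polynomial_intros)

lemma generic_inj_on:
  fixes p :: "'v::finite \<Rightarrow> real^2"
  assumes "generic V p"
  shows "inj_on p V"
proof (rule inj_onI, rule ccontr)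
  fix a b assume ab: "a \<in> V" "b \<in> V" "p a = p b" "a \<noteq> b"
  define q :: "'v \<Rightarrow> real^2" where "q v = (if v = a then vector [1, 0] else vector [0, 0])" for v
  have "p a $ 1 - p b $ 1 \<noteq> 0"
    by (rule generic_nonzero[OF assms, of "\<lambda>p. p a $ 1 - p b $ 1" q])
       (use ab in \<open>auto intro!: rat_polynomial_intros simp: q_def\<close>)
  then show False using ab by simp
qed

lemma generic_noncollinear:
  fixes p :: "'v::finite \<Rightarrow> real^2"
  assumes "generic V p" "a \<in> V" "b \<in> V" "c \<in> V" "distinct [a, b, c]"
  shows "area (p a) (p b) (p c) \<noteq> 0"
proof -
  define q :: "'v \<Rightarrow> real^2" where
    "q v = (if v = b then vector [1, 0] else if v = c then vector [0, 1] else vector [0, 0])" for v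
  show ?thesis
    by (rule generic_nonzero[OF assms(1) rat_polynomial_area[OF assms(2-4)], of q])
       (use assms(5) in \<open>auto simp: q_def area_def cross2_def\<close>)
qed

lemma generic_nonconic:
  fixes p :: "'v::finite \<Rightarrow> real^2"
  assumes "generic V p" and V: "set [a1, a2, a3, b1, b2, b3] \<subseteq> V" and dist: "distinct [a1, a2, a3, b1, b2, b3]"
  shows "conic_det (p a1) (p a2) (p a3) (p b1) (p b2) (p b3) \<noteq> 0"
proof -
  \<comment> \<open>The conics through the corners of the unit square are \<alpha> x (x - 1) +
    \<beta> y (y - 1) = 0. The point (3, 1) forces \<alpha> = 0 and then (2, 3) forces \<beta> = 0,
    so the six points lie on no conic.\<close>
  define q :: "'v \<Rightarrow> real^2" where
    "q v = (if v = a1 then vector [0, 0] else if v = a2 then vector [1, 0] else if v = a3 then vector [0, 1]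
      else if v = b1 then vector [1, 1] else if v = b2 then vector [2, 3] else vector [3, 1])" for v
  have q: "q a1 = vector [0, 0]" "q a2 = vector [1, 0]" "q a3 = vector [0, 1]"
      "q b1 = vector [1, 1]" "q b2 = vector [2, 3]" "q b3 = vector [3, 1]"
    using dist by (auto simp: q_def)
  show ?thesis
  proof (rule generic_nonzero[OF assms(1), of "\<lambda>p. conic_det (p a1) (p a2) (p a3) (p b1) (p b2) (p b3)" q])
    show "rat_polynomial (V \<times> UNIV) (\<lambda>x. conic_det (\<chi> i. x (a1, i)) (\<chi> i. x (a2, i)) (\<chi> i. x (a3, i))
        (\<chi> i. x (b1, i)) (\<chi> i. x (b2, i)) (\<chi> i. x (b3, i)))"
      unfolding conic_det_def
      by (intro rat_polynomial_diff rat_polynomial_mult rat_polynomial_area) (use V in auto)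
    show "conic_det (q a1) (q a2) (q a3) (q b1) (q b2) (q b3) \<noteq> 0"
      unfolding q by (simp add: conic_det_def area_def cross2_def)
  qed
qed

text \<open>Deleting \<open>uv\<close> allows some \<open>X\<close> of at most two vertices to
  disconnect the graph, although G - X is connected. If \<open>C\<close> is what \<open>s\<close>
  still reaches, then only \<open>uv\<close> can leave \<open>C\<close>, and by connectivity of G -
  X it does; so \<open>C\<close>, \<open>X\<close> and the rest are the required parts, up to
  exchanging the two sides.\<close>

lemma minimally_3_connected_edge_separation:
  assumes simple: "simple_graph V E" and min: "minimally_3_connected V E" and uv: "{u, v} \<in> E"
  shows "\<exists>A S B. V = A \<union> S \<union> B \<and> A \<inter> S = {} \<and> A \<inter> B = {} \<and> S \<inter> B = {} \<and> u \<in> A \<and> v \<in> B \<and> card S \<le> 2 \<and>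
      (\<forall>x\<in>A. \<forall>y\<in>B. {x, y} \<in> E \<longrightarrow> x = u \<and> y = v)"
proof -
  have E_V: "x \<in> V" "y \<in> V" if "{x, y} \<in> E" for x y
    using simple that unfolding simple_graph_def by auto
  have conn: "k_connected 3 V E" and "\<not> k_connected 3 V (E - {{u, v}})"
    using min uv by (auto simp: minimally_3_connected_def)
  \<comment> \<open>The failing clause is the one about cuts, because the number of vertices is the
    same with and without the edge.\<close>
  then obtain X where X: "X \<subseteq> V" "card X < 3"
      "\<not> graph_connected (V - X) {e \<in> E - {{u, v}}. e \<inter> X = {}}"
    unfolding k_connected_def by blast
  have GX: "graph_connected (V - X) {e \<in> E. e \<inter> X = {}}"
    using conn X(1,2) unfolding k_connected_def by blast
  define R where "R = {(x, y). {x, y} \<in> {e \<in> E - {{u, v}}. e \<inter> X = {}}}"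
  define R0 where "R0 = {(x, y). {x, y} \<in> {e \<in> E. e \<inter> X = {}}}"
  obtain s t where st: "s \<in> V - X" "t \<in> V - X" "(s, t) \<notin> R\<^sup>*"
    using X(3) GX unfolding graph_connected_def R_def by blast
  have "(s, t) \<in> R0\<^sup>*" using GX st unfolding graph_connected_def R0_def by blast
  define C where "C = {x \<in> V - X. (s, x) \<in> R\<^sup>*}"
  have cross: "{x, y} = {u, v}" if "x \<in> C" "y \<in> V - X - C" "{x, y} \<in> E" for x y
  proof (rule ccontr)
    assume "{x, y} \<noteq> {u, v}"
    then have "(x, y) \<in> R" using that by (auto simp: R_def C_def)
    then have "(s, y) \<in> R\<^sup>*" using that(1) by (auto simp: C_def)
    then show False using that(2) by (auto simp: C_def)
  qed
  have "\<exists>x\<in>C. \<exists>y\<in>V - X - C. {x, y} \<in> E"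
  proof (rule ccontr)
    assume none: "\<not> ?thesis"
    from \<open>(s, t) \<in> R0\<^sup>*\<close> have "t \<in> C"
    proof (induction rule: rtrancl_induct)
      case base
      then show ?case using st(1) by (simp add: C_def)
    next
      case (step y z)
      have "{y, z} \<in> E" "z \<notin> X" using step.hyps(2) by (auto simp: R0_def)
      moreover from this have "z \<in> V" using E_V by blast
      ultimately show ?case using none step.IH by blast
    qed
    then show False using st(3) by (simp add: C_def)
  qed
  then obtain x y where xy: "x \<in> C" "y \<in> V - X - C" "{x, y} = {u, v}" using cross by blast
  define D where "D = V - X - C"
  have part: "V = C \<union> X \<union> D" "C \<inter> X = {}" "C \<inter> D = {}" "X \<inter> D = {}" "card X \<le> 2"
    using X(1,2) by (auto simp: C_def D_def)
  have part': "V = D \<union> X \<union> C" "D \<inter> X = {}" "D \<inter> C = {}" "X \<inter> C = {}"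
    using part by blast+
  have cross': "{x, y} = {u, v}" if "x \<in> C" "y \<in> D" "{x, y} \<in> E" for x y
    using cross that unfolding D_def by blast
  have yD: "y \<in> D" using xy(2) by (simp add: D_def)
  consider "u = x" "v = y" | "u = y" "v = x" using xy(3) by (auto simp: doubleton_eq_iff)
  then show ?thesis
  proof cases
    case 1
    then have "u \<in> C" "v \<in> D" using xy(1) yD by simp_all
    moreover have "\<forall>a\<in>C. \<forall>b\<in>D. {a, b} \<in> E \<longrightarrow> a = u \<and> b = v"
      using cross' calculation part(3) by (fastforce simp: doubleton_eq_iff)
    ultimately show ?thesis
      by (intro exI[of _ C] exI[of _ X] exI[of _ D] conjI part)
  next
    case 2
    then have "u \<in> D" "v \<in> C" using xy(1) yD by simp_all
    moreover have "\<forall>a\<in>D. \<forall>b\<in>C. {a, b} \<in> E \<longrightarrow> a = u \<and> b = v"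
    proof (intro ballI impI)
      fix a b assume "a \<in> D" "b \<in> C" "{a, b} \<in> E"
      then have "{b, a} = {u, v}" using cross'[of b a] by (simp add: insert_commute)
      then show "a = u \<and> b = v"
        using \<open>u \<in> D\<close> \<open>b \<in> C\<close> part(3) by (auto simp: doubleton_eq_iff)
    qed
    ultimately show ?thesis
      by (intro exI[of _ D] exI[of _ X] exI[of _ C] conjI part(5) part')
  qed
qed

theorem theorem6p6:
  fixes V V' :: "'v::finite set" and E E' :: "'v set set"
  assumes "simple_graph V E"
    and "minimally_3_connected V E"
    and "subgraph V' E' V E"
    and "card V' \<ge> 8"
  shows "int (card E') \<le> int (r2 V' E') + int (card V') - 6 \<and>
         int (r2 V' E') + int (card V') - 6 \<le> 3 * (int (card V') - 3)"
proof -
  \<comment> \<open>Exactly the placement chosen inside \<open>r2\<close>, generic on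
    \<open>V'\<close>.\<close>
  define p :: "'v \<Rightarrow> real^2" where "p = (SOME p. generic V' p)"
  have p: "generic V' p" unfolding p_def using generic_exists by (rule someI_ex)
  have sub: "V' \<subseteq> V" "E' \<subseteq> E" "\<forall>e\<in>E'. e \<subseteq> V' \<and> card e = 2"
    using assms(3) by (auto simp: subgraph_def simple_graph_def)
  \<comment> \<open>The edge set of the locale is \<open>E'\<close>, so the subgraph is the one
    induced by \<open>V'\<close> there, even if it is not induced in the given graph.\<close>
  interpret edge_separated_framework E' p V'
  proof
    show "card e = 2" if "e \<in> E'" for e using sub(3) that by blast
    show "inj_on p V'" by (rule generic_inj_on[OF p])
    show "area (p a) (p b) (p c) \<noteq> 0" if "a \<in> V'" "b \<in> V'" "c \<in> V'" "distinct [a, b, c]" for a b c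
      by (rule generic_noncollinear[OF p that])
    show "conic_det (p a1) (p a2) (p a3) (p b1) (p b2) (p b3) \<noteq> 0"
      if "set [a1, a2, a3, b1, b2, b3] \<subseteq> V'" "distinct [a1, a2, a3, b1, b2, b3]" for a1 a2 a3 b1 b2 b3
      by (rule generic_nonconic[OF p that])
    fix u v assume uv: "{u, v} \<in> E'" "u \<in> V'" "v \<in> V'"
    then have "{u, v} \<in> E" using sub(2) by blast
    from minimally_3_connected_edge_separation[OF assms(1,2) this] obtain A S B where
      ASB: "V = A \<union> S \<union> B" "A \<inter> S = {}" "A \<inter> B = {}" "S \<inter> B = {}" "u \<in> A" "v \<in> B" "card S \<le> 2"
        "\<forall>x\<in>A. \<forall>y\<in>B. {x, y} \<in> E \<longrightarrow> x = u \<and> y = v" by blast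
    have "card (S \<inter> V') \<le> card S" by (intro card_mono) auto
    then have "card (S \<inter> V') \<le> 2" using ASB(7) by linarith
    moreover have "V' = (A \<inter> V') \<union> (S \<inter> V') \<union> (B \<inter> V')" using ASB(1) sub(1) by blast
    moreover have "\<forall>x\<in>A \<inter> V'. \<forall>y\<in>B \<inter> V'. {x, y} \<in> E' \<longrightarrow> x = u \<and> y = v"
      using ASB(8) sub(2) by blast
    moreover have "(A \<inter> V') \<inter> (S \<inter> V') = {}" "(A \<inter> V') \<inter> (B \<inter> V') = {}" "(S \<inter> V') \<inter> (B \<inter> V') = {}"
      "u \<in> A \<inter> V'" "v \<in> B \<inter> V'"
      using ASB(2-6) uv(2,3) by blast+
    ultimately show "\<exists>A S B. V' = A \<union> S \<union> B \<and> A \<inter> S = {} \<and> A \<inter> B = {} \<and> S \<inter> B = {} \<and> u \<in> A \<and> v \<in> B \<and>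
        card S \<le> 2 \<and> (\<forall>x\<in>A. \<forall>y\<in>B. {x, y} \<in> E' \<longrightarrow> x = u \<and> y = v)"
      by (intro exI[of _ "A \<inter> V'"] exI[of _ "S \<inter> V'"] exI[of _ "B \<inter> V'"] conjI)
  qed
  have E': "edges_in V' = E'" using sub(3) by (auto simp: edges_in_def)
  have rank: "dim (rigidity_rows p E') = r2 V' E'"
    by (simp add: r2_def rigidity_rank_def rigidity_rows_def p_def)
  have "nullity V' \<le> int (card V') - 6" using nullity_bound[of V'] assms(4) by simp
  then have lower: "int (card E') \<le> int (r2 V' E') + int (card V') - 6"
    by (simp add: nullity_def E' rank)
  \<comment> \<open>The second inequality: all rows are equilibrium loads on \<open>V'\<close>, a
    space of dimension at most 2n - 3.\<close>
  have "dim (rigidity_rows p E') \<le> dim (equilibrium_loads p V')"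
    using rows_equilibrium[of V'] by (simp add: E' dim_subset)
  then have "int (r2 V' E') \<le> 2 * int (card V') - 3"
    using dim_equilibrium_loads[of V'] assms(4) by (simp add: rank)
  with lower show ?thesis by auto
qed

end
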